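(* The following hold: (i) For all $(k,i)\in\Lambda$, $t\in[0,\infty)$, $\omega\in\Omega$ with $\min_{(l,j)\in\Lambda}\|V^{l,\xi(\omega)}_j\|>0$ it holds that $\psi^k_i(\Theta_t(\omega))=1$. (ii) For all $s\in[0,\infty)$, $t\in[s,\infty)$, $\omega\in\Omega$ with $\min_{(l,j)\in\Lambda}\|V^{l,\xi(\omega)}_j\|>0$ it holds that $\mathcal{L}_\infty(\Theta_t(\omega))\le\mathcal{L}_\infty(\Theta_s(\omega))$. (iii) For all $(k,i)\in\Lambda$, $n\in\mathbb{N}_0$, $\omega\in\Omega$ with $\min_{(l,j)\in\Lambda}\|V^{l,\vartheta_n(\omega)-\gamma_nG(\vartheta_n(\omega))}_j\|>0$ it holds that $\psi^k_i(\vartheta_{n+1}(\omega))=1$.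
   Context: Let $a\in\mathbb{R}$, $b\in(a,\infty)$, $L\in\{2,3,\dots\}$, $\ell_0,\ell_1,\dots,\ell_L\in\mathbb{N}=\{1,2,\dots\}$, and $d=\sum_{k=1}^L\ell_k(\ell_{k-1}+1)$. Norms and inner products are Euclidean. For every $\theta=(\theta_1,\dots,\theta_d)\in\mathbb{R}^d$ and $k\in\{1,\dots,L\}$ let $w^{k,\theta}=(w^{k,\theta}_{i,j})\in\mathbb{R}^{\ell_k\times\ell_{k-1}}$ and $b^{k,\theta}=(b^{k,\theta}_1,\dots,b^{k,\theta}_{\ell_k})\in\mathbb{R}^{\ell_k}$ be given for $i\in\{1,\dots,\ell_k\}$, $j\in\{1,\dots,\ell_{k-1}\}$ by $$w^{k,\theta}_{i,j}=\theta_{(i-1)\ell_{k-1}+j+\sum_{h=1}^{k-1}\ell_h(\ell_{h-1}+1)},\qquad b^{k,\theta}_i=\theta_{\ell_k\ell_{k-1}+i+\sum_{h=1}^{k-1}\ell_h(\ell_{h-1}+1)},$$ and let $A^\theta_k(x)=b^{k,\theta}+w^{k,\theta}x$ for $x\in\mathbb{R}^{\ell_{k-1}}$. Let $R_r\colon\mathbb{R}\to\mathbb{R}$, $r\in\mathbb{N}\cup\{\infty\}$, satisfy: $R_r\in C^1(\mathbb{R},\mathbb{R})$ for all $r\in\mathbb{N}$; $R_\infty(x)=\max\{x,0\}$; and for all $x\in\mathbb{R}$, $\sup_{r\in\mathbb{N}}\sup_{y\in[-|x|,|x|]}|(R_r)'(y)|<\infty$ and $$\limsup_{N\to\infty}\Bigl[\sum_{r=N}^\infty\mathbb{1}_{(0,\infty)}\bigl(|R_r(x)-R_\infty(x)|+|(R_r)'(x)-\mathbb{1}_{(0,\infty)}(x)|\bigr)\Bigr]=0.$$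 For $r\in\mathbb{N}\cup\{\infty\}$ let $\mathfrak{M}^k_r\colon\mathbb{R}^{\ell_k}\to\mathbb{R}^{\ell_k}$, $\mathfrak{M}^k_r(x_1,\dots,x_{\ell_k})=(R_r(x_1),\dots,R_r(x_{\ell_k}))$. Let $\mu$ be a finite measure on the Borel sets of $[a,b]^{\ell_0}$. For $\theta\in\mathbb{R}^d$, $r\in\mathbb{N}\cup\{\infty\}$ define $\mathcal{N}^{k,\theta}_r\colon\mathbb{R}^{\ell_0}\to\mathbb{R}^{\ell_k}$, $k\in\{1,\dots,L\}$, by $\mathcal{N}^{1,\theta}_r(x)=A^\theta_1(x)$ and, for $k\in\{1,\dots,L-1\}$, $$\mathcal{N}^{k+1,\theta}_r(x)=A^\theta_{k+1}\Bigl((\mathfrak{M}^k_r\circ\mathcal{N}^{k,\theta}_r)(x)-\mathbb{1}_{\{L\}}(k+1)\int_{[a,b]^{\ell_0}}(\mathfrak{M}^k_r\circ\mathcal{N}^{k,\theta}_r)(y)\,\mu(\mathrm{d}y)\Bigr).$$ Let $f\colon[a,b]^{\ell_0}\to\mathbb{R}^{\ell_L}$ be measurable and for $r\in\mathbb{N}\cup\{\infty\}$ let $\mathcal{L}_r\colon\mathbb{R}^d\to\mathbb{R}$ satisfy $\mathcal{L}_r(\theta)=\int_{[a,b]^{\ell_0}}\|\mathcal{N}^{L,\theta}_r(x)-f(x)\|^2\,\mu(\mathrm{d}x)$ for all $\theta$ (in particular, these integrals are finite). Let $\mathcal{G}\colon\mathbb{R}^d\to\mathbb{R}^d$ satisfy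 $\mathcal{G}(\theta)=\lim_{r\to\infty}(\nabla\mathcal{L}_r)(\theta)$ for every $\theta\in\mathbb{R}^d$ for which $((\nabla\mathcal{L}_r)(\theta))_{r\in\mathbb{N}}$ converges. For $k\in\{1,\dots,L\}$, $i\in\{1,\dots,\ell_k\}$, $\theta\in\mathbb{R}^d$ let $V^{k,\theta}_i=(w^{k,\theta}_{i,1},\dots,w^{k,\theta}_{i,\ell_{k-1}},b^{k,\theta}_i)\in\mathbb{R}^{\ell_{k-1}+1}$ and $\psi^k_i(\theta)=\|V^{k,\theta}_i\|^2$. Let $\Lambda=\bigcup_{k=1}^{L-1}(\{k\}\times\{1,2,\dots,\ell_k\})$. For $n\in\mathbb{N}$, $x\in\mathbb{R}^n$ let $\rho(x)=[\|x\|+\mathbb{1}_{\{0\}}(\|x\|)]^{-1}x\in\mathbb{R}^n$. Let $G\colon\mathbb{R}^d\to\mathbb{R}^d$ be $$G(\theta)=\mathcal{G}(\theta)-\sum_{(k,i)\in\Lambda}\bigl\langle\rho((\nabla\psi^k_i)(\theta)),\mathcal{G}(\theta)\bigr\rangle\,\rho((\nabla\psi^k_i)(\theta)).$$ Let $\phi\colon\mathbb{R}^d\to\mathbb{R}^d$ satisfy $V^{k,\phi(\theta)}_i=\rho(V^{k,\theta}_i)$ if $k<L$ and $V^{k,\phi(\theta)}_i=V^{k,\theta}_i$ if $k=L$. Define $\Psi_k\colon\mathbb{R}^d\to\mathbb{R}^d$, $k\in\{0,1,\dots,L-1\}$, recursively by $\Psi_0(\theta)=\theta$ and, for $k\in\{1,\dots,L-1\}$,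 $K\in\{1,\dots,L\}$, $i\in\{1,\dots,\ell_K\}$, $\theta\in\mathbb{R}^d$, $$V^{K,\Psi_k(\theta)}_i=\begin{cases}\rho(V^{K,\Psi_{k-1}(\theta)}_i)&: K=k\\ \operatorname{diag}\bigl(\|V^{k,\Psi_{k-1}(\theta)}_1\|,\dots,\|V^{k,\Psi_{k-1}(\theta)}_{\ell_k}\|,1\bigr)V^{K,\Psi_{k-1}(\theta)}_i&: K=k+1\\ V^{K,\Psi_{k-1}(\theta)}_i&: K\notin\{k,k+1\}.\end{cases}$$ Let $(\Omega,\mathcal{F},\mathbb{P})$ be a probability space, $\xi\colon\Omega\to\mathbb{R}^d$ a random variable, and let $\Theta\colon[0,\infty)\times\Omega\to\mathbb{R}^d$ satisfy for all $t\in[0,\infty)$, $\omega\in\Omega$ that $\int_0^t\|G(\Theta_s(\omega))\|\,\mathrm{d}s<\infty$ and $\Theta_t(\omega)=\Psi_{L-1}(\xi(\omega))-\int_0^tG(\Theta_s(\omega))\,\mathrm{d}s$. Let $(\gamma_n)_{n\in\mathbb{N}_0}\subseteq\mathbb{R}$ and let $\vartheta_n\colon\Omega\to\mathbb{R}^d$, $n\in\mathbb{N}_0$, satisfy $\vartheta_0(\omega)=\Psi_{L-1}(\xi(\omega))$ and $\vartheta_{n+1}(\omega)=\phi(\vartheta_n(\omega)-\gamma_nG(\vartheta_n(\omega)))$ for all $n\in\mathbb{N}_0$, $\omega\in\Omega$. *)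

theory Defs
  imports "HOL-Probability.Probability"
begin

text \<open>
  The parameter space \<open>\<real>\<^sup>d\<close> is the type \<^typ>\<open>real ^ 'd\<close>; an enumeration
  \<open>idx\<close>, assumed to be a bijection from \<open>{1..d}\<close> onto the index type, gives the coordinates
  \<open>\<theta>\<^sub>1, \<dots>, \<theta>\<^sub>d\<close> as \<open>\<theta> $ idx 1, \<dots>, \<theta> $ idx d\<close>.
  All other spaces \<open>\<real>\<^sup>n\<close>, whose dimensions vary with the layer, are rendered as
  \<open>{1..n} \<rightarrow>\<^sub>E UNIV\<close>, that is, as functions \<^typ>\<open>nat \<Rightarrow> real\<close> restricted
  to \<open>{1..n}\<close>; their Euclidean norm is \<^const>\<open>L2_set\<close> over \<open>{1..n}\<close>.
\<close>

definition grad :: "('a::real_inner \<Rightarrow> real) \<Rightarrow> 'a \<Rightarrow> 'a" where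
  "grad f x = (THE D. GDERIV f x :> D)"

lemma grad_eqI:
  assumes "GDERIV f x :> D"
  shows "grad f x = D"
  unfolding grad_def
proof (rule the_equality)
  fix D' assume "GDERIV f x :> D'"
  with assms have "(\<lambda>h. inner h D') = (\<lambda>h. inner h D)"
    unfolding gderiv_def using has_derivative_unique by blast
  then have "inner (D' - D) (D' - D) = 0"
    by (metis inner_diff_right right_minus_eq)
  then show "D' = D"
    by simp
qed (fact assms)

definition offset :: "(nat \<Rightarrow> nat) \<Rightarrow> nat \<Rightarrow> nat" where
  "offset l k = (\<Sum>h=1..k. l h * (l (h - 1) + 1))"

definition weight :: "(nat \<Rightarrow> 'd) \<Rightarrow> (nat \<Rightarrow> nat) \<Rightarrow> nat \<Rightarrow> real ^ 'd \<Rightarrow> nat \<Rightarrow> nat \<Rightarrow> real" where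
  "weight idx l k \<theta> i j = \<theta> $ idx ((i - 1) * l (k - 1) + j + offset l (k - 1))"

definition bias :: "(nat \<Rightarrow> 'd) \<Rightarrow> (nat \<Rightarrow> nat) \<Rightarrow> nat \<Rightarrow> real ^ 'd \<Rightarrow> nat \<Rightarrow> real" where
  "bias idx l k \<theta> i = \<theta> $ idx (l k * l (k - 1) + i + offset l (k - 1))"

definition affine_map ::
  "(nat \<Rightarrow> 'd) \<Rightarrow> (nat \<Rightarrow> nat) \<Rightarrow> nat \<Rightarrow> real ^ 'd \<Rightarrow> (nat \<Rightarrow> real) \<Rightarrow> nat \<Rightarrow> real" where
  "affine_map idx l k \<theta> x =
     (\<lambda>i\<in>{1..l k}. bias idx l k \<theta> i + (\<Sum>j=1..l (k - 1). weight idx l k \<theta> i j * x j))"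

definition multi_act :: "nat \<Rightarrow> (real \<Rightarrow> real) \<Rightarrow> (nat \<Rightarrow> real) \<Rightarrow> nat \<Rightarrow> real" where
  "multi_act n g x = (\<lambda>i\<in>{1..n}. g (x i))"

definition cube :: "nat \<Rightarrow> real \<Rightarrow> real \<Rightarrow> (nat \<Rightarrow> real) set" where
  "cube n a b = ({1..n} \<rightarrow>\<^sub>E {a..b})"

definition borel_cube :: "nat \<Rightarrow> real \<Rightarrow> real \<Rightarrow> (nat \<Rightarrow> real) measure" where
  "borel_cube n a b = restrict_space (\<Pi>\<^sub>M i\<in>{1..n}. borel) (cube n a b)"

text \<open>
  \<open>realization idx L l \<mu> g \<theta> k x\<close> is the output of the \<open>k\<close>-th affine layer on
  input \<open>x\<close>, for activation \<open>g\<close>. Layers are numbered from 1, so the value at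
  \<open>k = 0\<close> is a dummy. The measure \<open>\<mu>\<close> is meant to live on the input cube, so the
  integral over \<open>\<mu>\<close> is the integral over the cube; it is taken componentwise.
\<close>

fun realization ::
  "(nat \<Rightarrow> 'd) \<Rightarrow> nat \<Rightarrow> (nat \<Rightarrow> nat) \<Rightarrow> (nat \<Rightarrow> real) measure \<Rightarrow> (real \<Rightarrow> real) \<Rightarrow> real ^ 'd
    \<Rightarrow> nat \<Rightarrow> (nat \<Rightarrow> real) \<Rightarrow> nat \<Rightarrow> real" where
  "realization idx L l \<mu> g \<theta> 0 x = x"
| "realization idx L l \<mu> g \<theta> (Suc 0) x = affine_map idx l 1 \<theta> x"
| "realization idx L l \<mu> g \<theta> (Suc (Suc k)) x =
     affine_map idx l (Suc (Suc k)) \<theta>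
       (\<lambda>i\<in>{1..l (Suc k)}.
          multi_act (l (Suc k)) g (realization idx L l \<mu> g \<theta> (Suc k) x) i
          - indicator {L} (Suc (Suc k))
            * (\<integral>y. multi_act (l (Suc k)) g (realization idx L l \<mu> g \<theta> (Suc k) y) i \<partial>\<mu>))"

definition V :: "(nat \<Rightarrow> 'd) \<Rightarrow> (nat \<Rightarrow> nat) \<Rightarrow> nat \<Rightarrow> real ^ 'd \<Rightarrow> nat \<Rightarrow> nat \<Rightarrow> real" where
  "V idx l k \<theta> i =
     (\<lambda>j\<in>{1..l (k - 1) + 1}. if j \<le> l (k - 1) then weight idx l k \<theta> i j else bias idx l k \<theta> i)"

definition norm_V :: "(nat \<Rightarrow> 'd) \<Rightarrow> (nat \<Rightarrow> nat) \<Rightarrow> nat \<Rightarrow> real ^ 'd \<Rightarrow> nat \<Rightarrow> real" where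
  "norm_V idx l k \<theta> i = L2_set (V idx l k \<theta> i) {1..l (k - 1) + 1}"

definition psi :: "(nat \<Rightarrow> 'd) \<Rightarrow> (nat \<Rightarrow> nat) \<Rightarrow> nat \<Rightarrow> nat \<Rightarrow> real ^ 'd \<Rightarrow> real" where
  "psi idx l k i \<theta> = (norm_V idx l k \<theta> i)\<^sup>2"

definition Lam :: "nat \<Rightarrow> (nat \<Rightarrow> nat) \<Rightarrow> (nat \<times> nat) set" where
  "Lam L l = (\<Union>k\<in>{1..L - 1}. {k} \<times> {1..l k})"

text \<open>
  The normalization \<open>\<rho>\<close> occurs on the parameter space (\<open>rho\<close>) and on the spaces
  \<open>{1..n} \<rightarrow>\<^sub>E UNIV\<close> (\<open>rho_fun\<close>).
\<close>

definition rho :: "'a::real_normed_vector \<Rightarrow> 'a" where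
  "rho x = inverse (norm x + indicator {0} (norm x)) *\<^sub>R x"

definition rho_fun :: "nat \<Rightarrow> (nat \<Rightarrow> real) \<Rightarrow> nat \<Rightarrow> real" where
  "rho_fun n x =
     (\<lambda>j\<in>{1..n}. inverse (L2_set x {1..n} + indicator {0} (L2_set x {1..n})) * x j)"

definition diag_mult :: "nat \<Rightarrow> (nat \<Rightarrow> real) \<Rightarrow> (nat \<Rightarrow> real) \<Rightarrow> nat \<Rightarrow> real" where
  "diag_mult n c x = (\<lambda>j\<in>{1..n}. c j * x j)"

end

theory Submission
  imports Defs
begin

text \<open>
  The vectors \<open>V\<^sup>k\<^sub>i\<close> occupy disjoint sets of coordinates, so the gradients of the \<open>\<psi>\<^sup>k\<^sub>i\<close> are
  pairwise orthogonal and \<open>G\<close> is the component of \<open>\<G>\<close> orthogonal to all of them. Hence every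
  \<open>\<psi>\<^sup>k\<^sub>i\<close> is constant along the flow, and \<open>\<langle>\<G>, G\<rangle> = \<parallel>G\<parallel>\<^sup>2\<close>. The limit loss is not differentiable, but
  the losses of the approximations are \<open>C\<^sup>1\<close>, and at every parameter their values and gradients
  converge, with locally uniform bounds. So \<open>\<G>\<close> is this limit everywhere, and dominated convergence
  carries the chain rule along the flow over to the limit loss, which changes by \<open>- \<integral> \<parallel>G\<parallel>\<^sup>2 \<le> 0\<close>.
\<close>

section \<open>Parametric families with convergent gradients\<close>

text \<open>The limit derivative of the activation jumps at 0. If hidden preactivations merely
  converged to 0, nothing could be said about the derivatives of the approximations there. The
  limsup hypothesis is stronger than convergence: at each real number only finitely many indices
  differ from the limit, and this carries gradients through any number of activations at a fixed
  input. The position of the centring integral is essential here. It stands behind the last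
  activation, so only an affine map and the square follow it, and for these plain convergence
  suffices. The target \<open>f\<close> is merely measurable, so the square integrability needed to
  expand the loss is drawn from the finiteness of one of the losses, networks being bounded on the
  cube. At time 0, \<open>\<Psi>\<close> has normalized the hidden layers one after the other. Each
  step also rescales the next layer by the norms that it removes, so it has to be shown that no
  vector vanishes before its own turn.\<close>

definition conv_to :: "bool \<Rightarrow> (nat \<Rightarrow> 'b::topological_space) \<Rightarrow> 'b \<Rightarrow> bool" where
  "conv_to e X y \<longleftrightarrow> (if e then \<forall>\<^sub>F n in sequentially. X n = y else X \<longlonglongrightarrow> y)"

lemma conv_to_imp_tendsto: "conv_to e X y \<Longrightarrow> X \<longlonglongrightarrow> y"
  by (auto simp: conv_to_def tendsto_eventually split: if_splits)

lemma conv_to_const: "conv_to e (\<lambda>_. y) y"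
  by (simp add: conv_to_def)

text \<open>Eventual equality passes through every \<open>h\<close>, continuous or not; the third
  assumption is the continuity that plain convergence asks for. Having both modes in one predicate
  lets the closure under sums and products be proved once.\<close>

lemma conv_to_combine:
  assumes "conv_to e X x" and "conv_to e Y y"
    and "(\<lambda>n. h (X n) (Y n)) \<longlonglongrightarrow> h x y"
  shows "conv_to e (\<lambda>n. h (X n) (Y n)) (h x y)"
proof (cases e)
  case True
  then have "\<forall>\<^sub>F n in sequentially. X n = x" "\<forall>\<^sub>F n in sequentially. Y n = y"
    using assms by (auto simp: conv_to_def)
  then have "\<forall>\<^sub>F n in sequentially. h (X n) (Y n) = h x y"
    by eventually_elim simp
  with True show ?thesis
    by (simp add: conv_to_def)
qed (use assms in \<open>simp add: conv_to_def\<close>)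

lemma conv_to_add:
  fixes x y :: "'b::real_normed_vector"
  shows "conv_to e X x \<Longrightarrow> conv_to e Y y \<Longrightarrow> conv_to e (\<lambda>n. X n + Y n) (x + y)"
  by (rule conv_to_combine) (auto intro: tendsto_add conv_to_imp_tendsto)

lemma conv_to_scaleR:
  fixes y :: "'b::real_normed_vector"
  shows "conv_to e X x \<Longrightarrow> conv_to e Y y \<Longrightarrow> conv_to e (\<lambda>n. X n *\<^sub>R Y n) (x *\<^sub>R y)"
  by (rule conv_to_combine) (auto intro: tendsto_scaleR conv_to_imp_tendsto)

text \<open>
  Families indexed by \<^typ>\<open>enat\<close>: the finite indices are the smooth approximations, the index
  \<open>\<infinity>\<close> is their limit. Only the finite members need be differentiable in the parameter; the
  gradient \<open>DF \<infinity>\<close> is merely the pointwise limit of the others. The flag \<open>e\<close> asks for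
  convergence by being eventually equal, which survives composition with the discontinuous limit of
  \<open>(R\<^sub>r)'\<close> but not integration over the inputs, hence is available up to the last hidden layer only.
\<close>

definition tame_with :: "bool \<Rightarrow> 'x measure \<Rightarrow> (enat \<Rightarrow> 'a::euclidean_space \<Rightarrow> 'x \<Rightarrow> real)
    \<Rightarrow> (enat \<Rightarrow> 'a \<Rightarrow> 'x \<Rightarrow> 'a) \<Rightarrow> bool" where
  "tame_with e M F DF \<longleftrightarrow>
     (\<forall>r \<theta>. F r \<theta> \<in> borel_measurable M) \<and> (\<forall>r \<theta>. DF r \<theta> \<in> borel_measurable M) \<and>
     (\<forall>n \<theta>. \<forall>x\<in>space M. GDERIV (\<lambda>\<theta>. F (enat n) \<theta> x) \<theta> :> DF (enat n) \<theta> x) \<and>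
     (\<forall>n. \<forall>x\<in>space M. continuous_on UNIV (\<lambda>\<theta>. DF (enat n) \<theta> x)) \<and>
     (\<forall>B. \<exists>C. \<forall>r. \<forall>\<theta>\<in>cball 0 B. \<forall>x\<in>space M. \<bar>F r \<theta> x\<bar> \<le> C \<and> norm (DF r \<theta> x) \<le> C) \<and>
     (\<forall>\<theta>. \<forall>x\<in>space M. conv_to e (\<lambda>n. F (enat n) \<theta> x) (F \<infinity> \<theta> x) \<and>
        conv_to e (\<lambda>n. DF (enat n) \<theta> x) (DF \<infinity> \<theta> x))"

text \<open>The gradient family is hidden, so that networks and losses can be assembled from closure
  properties without writing out backpropagation. Its member at \<open>\<infinity>\<close> is
  identified only at the end, as the limit of the gradients of the losses.\<close>

definition tame :: "bool \<Rightarrow> 'x measure \<Rightarrow> (enat \<Rightarrow> 'a::euclidean_space \<Rightarrow> 'x \<Rightarrow> real) \<Rightarrow> bool" where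
  "tame e M F \<longleftrightarrow> (\<exists>DF. tame_with e M F DF)"

lemma tame_withD:
  assumes "tame_with e M F DF"
  shows "F r \<theta> \<in> borel_measurable M" "DF r \<theta> \<in> borel_measurable M"
    "x \<in> space M \<Longrightarrow> GDERIV (\<lambda>\<theta>. F (enat n) \<theta> x) \<theta> :> DF (enat n) \<theta> x"
    "x \<in> space M \<Longrightarrow> continuous_on UNIV (\<lambda>\<theta>. DF (enat n) \<theta> x)"
    "x \<in> space M \<Longrightarrow> conv_to e (\<lambda>n. F (enat n) \<theta> x) (F \<infinity> \<theta> x)"
    "x \<in> space M \<Longrightarrow> conv_to e (\<lambda>n. DF (enat n) \<theta> x) (DF \<infinity> \<theta> x)"
  using assms by (auto simp: tame_with_def)

lemma tame_with_bound:
  assumes "tame_with e M F DF"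
  obtains C where "C \<ge> 0" "\<And>r \<theta> x. \<theta> \<in> cball 0 B \<Longrightarrow> x \<in> space M \<Longrightarrow> \<bar>F r \<theta> x\<bar> \<le> C"
    "\<And>r \<theta> x. \<theta> \<in> cball 0 B \<Longrightarrow> x \<in> space M \<Longrightarrow> norm (DF r \<theta> x) \<le> C"
proof -
  obtain C where C: "\<forall>r. \<forall>\<theta>\<in>cball 0 B. \<forall>x\<in>space M. \<bar>F r \<theta> x\<bar> \<le> C \<and> norm (DF r \<theta> x) \<le> C"
    using assms unfolding tame_with_def by blast
  \<comment> \<open>On a ball or space that is empty the given constant may be negative, hence its
    absolute value.\<close>
  then have "\<bar>F r \<theta> x\<bar> \<le> \<bar>C\<bar>" "norm (DF r \<theta> x) \<le> \<bar>C\<bar>"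
    if "\<theta> \<in> cball 0 B" "x \<in> space M" for r \<theta> x
    using that abs_ge_self[of C] order_trans by blast+
  then show thesis
    using that[of "\<bar>C\<bar>"] by simp
qed

lemma tame_with_continuous:
  assumes "tame_with e M F DF" "x \<in> space M"
  shows "continuous_on UNIV (\<lambda>\<theta>. F (enat n) \<theta> x)"
  using tame_withD(3)[OF assms]
  by (auto simp: gderiv_def continuous_on_eq_continuous_at intro: has_derivative_continuous)

section \<open>Closure of tame families under algebraic operations\<close>

lemma tame_weaken:
  assumes "tame e M F"
  shows "tame False M F"
proof -
  obtain DF where D: "tame_with e M F DF"
    using assms by (auto simp: tame_def)
  have "conv_to False (\<lambda>n. F (enat n) \<theta> x) (F \<infinity> \<theta> x)"
    "conv_to False (\<lambda>n. DF (enat n) \<theta> x) (DF \<infinity> \<theta> x)" if "x \<in> space M" for \<theta> x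
    using tame_withD(5,6)[OF D that, of \<theta>] conv_to_imp_tendsto by (auto simp: conv_to_def[of False])
  with D have "tame_with False M F DF"
    by (simp add: tame_with_def)
  then show ?thesis
    by (auto simp: tame_def)
qed

lemma tame_cong:
  assumes "tame e M F" "\<And>r \<theta> x. x \<in> space M \<Longrightarrow> F' r \<theta> x = F r \<theta> x"
  shows "tame e M F'"
proof -
  obtain DF where DF: "tame_with e M F DF"
    using assms(1) by (auto simp: tame_def)
  have "F' r \<theta> \<in> borel_measurable M" for r \<theta>
    using tame_withD(1)[OF DF, of r \<theta>] measurable_cong[of M "F' r \<theta>" "F r \<theta>"] assms(2) by blast
  then have "tame_with e M F' DF"
    using DF assms(2) by (simp add: tame_with_def)
  then show ?thesis
    by (auto simp: tame_def)
qed

lemma tame_const: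
  assumes "u \<in> borel_measurable M" "\<And>x. x \<in> space M \<Longrightarrow> \<bar>u x\<bar> \<le> B"
  shows "tame e M (\<lambda>r (\<theta>::'a::euclidean_space) x. u x)"
  unfolding tame_def tame_with_def
  by (rule exI[of _ "\<lambda>r \<theta> x. 0"])
    (use assms in \<open>fastforce simp: conv_to_const GDERIV_const intro: exI[of _ "\<bar>B\<bar>"]\<close>)

lemma tame_inner: "tame e M (\<lambda>r (\<theta>::'a::euclidean_space) x. \<theta> \<bullet> v)"
  unfolding tame_def tame_with_def
proof (intro exI[of _ "\<lambda>r \<theta> x. v"] conjI allI ballI)
  fix B :: real
  have "\<bar>\<theta> \<bullet> v\<bar> \<le> B * norm v" if "norm \<theta> \<le> B" for \<theta>
    using Cauchy_Schwarz_ineq2[of \<theta> v] mult_right_mono[OF that norm_ge_zero[of v]] by linarith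
  then show "\<exists>C. \<forall>r. \<forall>\<theta>\<in>cball 0 B. \<forall>x\<in>space M. \<bar>\<theta> \<bullet> v\<bar> \<le> C \<and> norm v \<le> C"
    by (intro exI[of _ "max (B * norm v) (norm v)"]) (auto simp: le_max_iff_disj)
qed (auto simp: conv_to_const gderiv_def bounded_linear_imp_has_derivative bounded_linear_inner_left)

lemma tame_add:
  assumes "tame e M F" "tame e M H"
  shows "tame e M (\<lambda>r \<theta> x. F r \<theta> x + H r \<theta> x)"
proof -
  obtain DF DH where D: "tame_with e M F DF" "tame_with e M H DH"
    using assms by (auto simp: tame_def)
  show ?thesis
    unfolding tame_def tame_with_def
  proof (intro exI[of _ "\<lambda>r \<theta> x. DF r \<theta> x + DH r \<theta> x"] conjI allI ballI)
    fix B
    obtain C where C: "\<And>r \<theta> x. \<theta> \<in> cball 0 B \<Longrightarrow> x \<in> space M \<Longrightarrow> \<bar>F r \<theta> x\<bar> \<le> C"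
      "\<And>r \<theta> x. \<theta> \<in> cball 0 B \<Longrightarrow> x \<in> space M \<Longrightarrow> norm (DF r \<theta> x) \<le> C"
      using tame_with_bound[OF D(1)] by metis
    obtain C' where C': "\<And>r \<theta> x. \<theta> \<in> cball 0 B \<Longrightarrow> x \<in> space M \<Longrightarrow> \<bar>H r \<theta> x\<bar> \<le> C'"
      "\<And>r \<theta> x. \<theta> \<in> cball 0 B \<Longrightarrow> x \<in> space M \<Longrightarrow> norm (DH r \<theta> x) \<le> C'"
      using tame_with_bound[OF D(2)] by metis
    show "\<exists>C. \<forall>r. \<forall>\<theta>\<in>cball 0 B. \<forall>x\<in>space M.
        \<bar>F r \<theta> x + H r \<theta> x\<bar> \<le> C \<and> norm (DF r \<theta> x + DH r \<theta> x) \<le> C"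
      by (intro exI[of _ "C + C'"])
        (meson C C' add_mono norm_triangle_mono abs_triangle_ineq order_trans)
  qed (use tame_withD[OF D(1)] tame_withD[OF D(2)] in
      \<open>auto intro!: GDERIV_add conv_to_add continuous_intros\<close>)
qed

lemma tame_mult:
  assumes "tame e M F" "tame e M H"
  shows "tame e M (\<lambda>r \<theta> x. F r \<theta> x * H r \<theta> x)"
proof -
  obtain DF DH where D: "tame_with e M F DF" "tame_with e M H DH"
    using assms by (auto simp: tame_def)
  note D1 = tame_withD[OF D(1)] and D2 = tame_withD[OF D(2)]
  show ?thesis
    unfolding tame_def tame_with_def
  proof (intro exI[of _ "\<lambda>r \<theta> x. F r \<theta> x *\<^sub>R DH r \<theta> x + H r \<theta> x *\<^sub>R DF r \<theta> x"] conjI allI ballI)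
    fix B
    obtain C where C: "C \<ge> 0" "\<And>r \<theta> x. \<theta> \<in> cball 0 B \<Longrightarrow> x \<in> space M \<Longrightarrow> \<bar>F r \<theta> x\<bar> \<le> C"
      "\<And>r \<theta> x. \<theta> \<in> cball 0 B \<Longrightarrow> x \<in> space M \<Longrightarrow> norm (DF r \<theta> x) \<le> C"
      using tame_with_bound[OF D(1)] by metis
    obtain C' where C': "C' \<ge> 0" "\<And>r \<theta> x. \<theta> \<in> cball 0 B \<Longrightarrow> x \<in> space M \<Longrightarrow> \<bar>H r \<theta> x\<bar> \<le> C'"
      "\<And>r \<theta> x. \<theta> \<in> cball 0 B \<Longrightarrow> x \<in> space M \<Longrightarrow> norm (DH r \<theta> x) \<le> C'"
      using tame_with_bound[OF D(2)] by metis
    \<comment> \<open>The constant is the one that the product rule yields for the gradient; it also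
      dominates the value, which needs only one of the two equal summands.\<close>
    have "\<bar>F r \<theta> x * H r \<theta> x\<bar> \<le> C * C' + C' * C"
      "norm (F r \<theta> x *\<^sub>R DH r \<theta> x + H r \<theta> x *\<^sub>R DF r \<theta> x) \<le> C * C' + C' * C"
      if "\<theta> \<in> cball 0 B" "x \<in> space M" for r \<theta> x
    proof -
      have "\<bar>F r \<theta> x\<bar> * \<bar>H r \<theta> x\<bar> \<le> C * C'"
        using C C' that by (intro mult_mono) auto
      then show "\<bar>F r \<theta> x * H r \<theta> x\<bar> \<le> C * C' + C' * C"
        using mult_nonneg_nonneg[OF C'(1) C(1)] unfolding abs_mult mult.commute[of C' C] by linarith
      show "norm (F r \<theta> x *\<^sub>R DH r \<theta> x + H r \<theta> x *\<^sub>R DF r \<theta> x) \<le> C * C' + C' * C"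
        using C C' that by (intro norm_triangle_mono) (auto intro!: mult_mono)
    qed
    then show "\<exists>C. \<forall>r. \<forall>\<theta>\<in>cball 0 B. \<forall>x\<in>space M. \<bar>F r \<theta> x * H r \<theta> x\<bar> \<le> C
       \<and> norm (F r \<theta> x *\<^sub>R DH r \<theta> x + H r \<theta> x *\<^sub>R DF r \<theta> x) \<le> C"
      by blast
  next
    fix \<theta> x assume "x \<in> space M"
    then show "conv_to e (\<lambda>n. F (enat n) \<theta> x * H (enat n) \<theta> x) (F \<infinity> \<theta> x * H \<infinity> \<theta> x)"
      using conv_to_scaleR[OF D1(5) D2(5)] by simp
  qed (use D1 D2 tame_with_continuous[OF D(1)] tame_with_continuous[OF D(2)] in
      \<open>auto intro!: GDERIV_mult conv_to_add conv_to_scaleR continuous_intros\<close>)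
qed

lemma tame_sum:
  assumes "finite J" "\<And>j. j \<in> J \<Longrightarrow> tame e M (F j)"
  shows "tame e M (\<lambda>r \<theta> x. \<Sum>j\<in>J. F j r \<theta> x)"
  using assms
proof (induction J)
  case empty
  show ?case using tame_const[of "\<lambda>_. 0" M 0] by simp
qed (simp add: tame_add)

lemma tame_cmult:
  "tame e M F \<Longrightarrow> tame e M (\<lambda>r \<theta> x. c * F r \<theta> x)"
  by (rule tame_mult) (auto intro: tame_const[where B="\<bar>c\<bar>"])

text \<open>\<open>S'\<close> is a separate family because its member at \<open>\<infinity>\<close>
  is a pointwise limit and need not be a derivative: the limit activation has a kink at 0, where the
  indicator still assigns a value. The bounds are uniform in the index, \<open>\<infinity>\<close>
  included, as dominated convergence will ask.\<close>

definition activation :: "(enat \<Rightarrow> real \<Rightarrow> real) \<Rightarrow> (enat \<Rightarrow> real \<Rightarrow> real) \<Rightarrow> bool" where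
  "activation S S' \<longleftrightarrow>
     (\<forall>r. S r \<in> borel_measurable borel \<and> S' r \<in> borel_measurable borel) \<and>
     (\<forall>n y. DERIV (S (enat n)) y :> S' (enat n) y) \<and> (\<forall>n. continuous_on UNIV (S' (enat n))) \<and>
     (\<forall>B. \<exists>C. \<forall>r. \<forall>y. \<bar>y\<bar> \<le> B \<longrightarrow> \<bar>S r y\<bar> \<le> C \<and> \<bar>S' r y\<bar> \<le> C) \<and>
     (\<forall>y. \<forall>\<^sub>F n in sequentially. S (enat n) y = S \<infinity> y \<and> S' (enat n) y = S' \<infinity> y)"

text \<open>At a fixed parameter and input, \<open>F (enat n)\<close> is eventually frozen at its
  limit \<open>y\<close>, and from then on only the behaviour of \<open>S (enat n)\<close> and
  \<open>S' (enat n)\<close> at the single point \<open>y\<close> matters. This is why the flag is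
  \<open>True\<close>: with values that only approach a jump of \<open>S' \<infinity>\<close>, the
  gradients might not converge.\<close>

lemma tame_compose:
  assumes S: "activation S S'" and "tame True M F"
  shows "tame True M (\<lambda>r \<theta> x. S r (F r \<theta> x))"
proof -
  obtain DF where D: "tame_with True M F DF"
    using assms by (auto simp: tame_def)
  note D1 = tame_withD[OF D(1)]
  have [measurable]: "S r \<in> borel_measurable borel" "S' r \<in> borel_measurable borel"
    "F r \<theta> \<in> borel_measurable M" "DF r \<theta> \<in> borel_measurable M" for r \<theta>
    using S D1 by (auto simp: activation_def)
  show ?thesis
    unfolding tame_def tame_with_def
  proof (intro exI[of _ "\<lambda>r \<theta> x. S' r (F r \<theta> x) *\<^sub>R DF r \<theta> x"] conjI allI ballI)
    fix B
    obtain C where C: "C \<ge> 0" "\<And>r \<theta> x. \<theta> \<in> cball 0 B \<Longrightarrow> x \<in> space M \<Longrightarrow> \<bar>F r \<theta> x\<bar> \<le> C"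
      "\<And>r \<theta> x. \<theta> \<in> cball 0 B \<Longrightarrow> x \<in> space M \<Longrightarrow> norm (DF r \<theta> x) \<le> C"
      using tame_with_bound[OF D(1)] by metis
    obtain C' where C': "\<And>r y. \<bar>y\<bar> \<le> C \<Longrightarrow> \<bar>S r y\<bar> \<le> C' \<and> \<bar>S' r y\<bar> \<le> C'"
      using S unfolding activation_def by meson
    have "C' \<ge> 0"
      using C'[of 0 0] C(1) abs_ge_zero[of "S 0 0"] by linarith
    have "\<bar>S r (F r \<theta> x)\<bar> \<le> max C' (C' * C)" "norm (S' r (F r \<theta> x) *\<^sub>R DF r \<theta> x) \<le> max C' (C' * C)"
      if "\<theta> \<in> cball 0 B" "x \<in> space M" for r \<theta> x
    proof -
      show "\<bar>S r (F r \<theta> x)\<bar> \<le> max C' (C' * C)"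
        using C'[OF C(2)[OF that]] by (simp add: le_max_iff_disj)
      have "\<bar>S' r (F r \<theta> x)\<bar> * norm (DF r \<theta> x) \<le> C' * C"
        using C' C that \<open>C' \<ge> 0\<close> by (intro mult_mono) auto
      then show "norm (S' r (F r \<theta> x) *\<^sub>R DF r \<theta> x) \<le> max C' (C' * C)"
        by (simp add: le_max_iff_disj)
    qed
    then show "\<exists>C. \<forall>r. \<forall>\<theta>\<in>cball 0 B. \<forall>x\<in>space M. \<bar>S r (F r \<theta> x)\<bar> \<le> C
       \<and> norm (S' r (F r \<theta> x) *\<^sub>R DF r \<theta> x) \<le> C"
      by blast
  next
    fix n x assume "x \<in> space M"
    have "continuous_on UNIV (S' (enat n))"
      using S by (simp add: activation_def)
    from continuous_on_compose2[OF this tame_with_continuous[OF D \<open>x \<in> space M\<close>]]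
    show "continuous_on UNIV (\<lambda>\<theta>. S' (enat n) (F (enat n) \<theta> x) *\<^sub>R DF (enat n) \<theta> x)"
      using D1(4)[OF \<open>x \<in> space M\<close>] by (intro continuous_on_scaleR) auto
  next
    fix n \<theta> x assume "x \<in> space M"
    then show "GDERIV (\<lambda>\<theta>. S (enat n) (F (enat n) \<theta> x)) \<theta> :> S' (enat n) (F (enat n) \<theta> x) *\<^sub>R DF (enat n) \<theta> x"
      using S GDERIV_DERIV_compose[OF D1(3)] by (simp add: activation_def)
  next
    fix \<theta> x assume "x \<in> space M"
    then have *: "\<forall>\<^sub>F n in sequentially. F (enat n) \<theta> x = F \<infinity> \<theta> x"
      "\<forall>\<^sub>F n in sequentially. DF (enat n) \<theta> x = DF \<infinity> \<theta> x"
      using D1(5,6) by (auto simp: conv_to_def)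
    have **: "\<forall>\<^sub>F n in sequentially. S (enat n) y = S \<infinity> y \<and> S' (enat n) y = S' \<infinity> y" for y
      using S by (auto simp: activation_def)
    show "conv_to True (\<lambda>n. S (enat n) (F (enat n) \<theta> x)) (S \<infinity> (F \<infinity> \<theta> x))"
      using *(1) **[of "F \<infinity> \<theta> x"] unfolding conv_to_def if_True by eventually_elim simp
    show "conv_to True (\<lambda>n. S' (enat n) (F (enat n) \<theta> x) *\<^sub>R DF (enat n) \<theta> x)
        (S' \<infinity> (F \<infinity> \<theta> x) *\<^sub>R DF \<infinity> \<theta> x)"
      using * **[of "F \<infinity> \<theta> x"] unfolding conv_to_def if_True by eventually_elim simp
  qed measurable
qed

section \<open>Differentiation and limits under the integral sign\<close>

lemma gderiv_difference_bound:
  fixes F :: "'a::euclidean_space \<Rightarrow> real"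
  assumes "\<And>p. GDERIV F p :> D p" "\<And>p. p \<in> cball 0 B \<Longrightarrow> norm (D p) \<le> C"
    "p \<in> cball 0 B" "q \<in> cball 0 B"
  shows "\<bar>F p - F q\<bar> \<le> C * norm (p - q)"
proof -
  have "norm (F p - F q) \<le> C * norm (p - q)"
  proof (rule differentiable_bound[OF convex_cball])
    show "(F has_derivative (\<lambda>h. h \<bullet> D x)) (at x within cball 0 B)" for x
      using assms(1)[of x] by (auto simp: gderiv_def intro: has_derivative_at_withinI)
    show "onorm (\<lambda>h. h \<bullet> D x) \<le> C" if "x \<in> cball 0 B" for x
    proof (rule onorm_le)
      fix h
      have "\<bar>h \<bullet> D x\<bar> \<le> norm h * norm (D x)" by (rule Cauchy_Schwarz_ineq2)
      also have "\<dots> \<le> norm h * C" using assms(2)[OF that] by (intro mult_left_mono) auto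
      finally show "norm (h \<bullet> D x) \<le> C * norm h" by (simp add: mult.commute)
    qed
  qed (use assms in auto)
  then show ?thesis by simp
qed

lemma tendsto_subset_cball:
  fixes X :: "nat \<Rightarrow> 'a::real_normed_vector"
  assumes "X \<longlonglongrightarrow> y"
  obtains B where "y \<in> cball 0 B" "\<And>n. X n \<in> cball 0 B"
proof -
  have "Bseq X" using assms by (auto intro: convergent_imp_Bseq convergentI)
  then obtain K where K: "\<And>n. norm (X n) \<le> K" by (auto simp: Bseq_def)
  moreover have "norm y \<le> K"
    by (rule LIMSEQ_le_const2[OF tendsto_norm[OF assms]]) (use K in auto)
  ultimately show thesis using that[of K] by auto
qed

text \<open>Dominated convergence applies to the difference quotients along sequences. A convergent
  sequence stays in one ball together with its limit, so a gradient bound that is only locally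
  uniform provides a single dominating function.\<close>

lemma gderiv_integral:
  fixes F :: "'a::euclidean_space \<Rightarrow> 'x \<Rightarrow> real"
  assumes int: "\<And>\<theta>. integrable M (F \<theta>)" "\<And>\<theta>. integrable M (DF \<theta>)"
    and der: "\<And>\<theta> x. x \<in> space M \<Longrightarrow> GDERIV (\<lambda>\<theta>. F \<theta> x) \<theta> :> DF \<theta> x"
    and bound: "\<And>B. \<exists>g. integrable M g \<and> (\<forall>\<theta>\<in>cball 0 B. \<forall>x\<in>space M. norm (DF \<theta> x) \<le> g x)"
  shows "GDERIV (\<lambda>\<theta>. \<integral>x. F \<theta> x \<partial>M) \<theta> :> (\<integral>x. DF \<theta> x \<partial>M)"
  unfolding gderiv_def has_derivative_at
proof (intro conjI)
  show "bounded_linear (\<lambda>h. h \<bullet> (\<integral>x. DF \<theta> x \<partial>M))"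
    by (rule bounded_linear_inner_left)
  let ?f = "\<lambda>h x. (F (\<theta> + h) x - F \<theta> x - h \<bullet> DF \<theta> x) / norm h"
  let ?Q = "\<lambda>h. norm ((\<integral>x. F (\<theta> + h) x \<partial>M) - (\<integral>x. F \<theta> x \<partial>M) - h \<bullet> (\<integral>x. DF \<theta> x \<partial>M)) / norm h"
  have eq: "(\<integral>x. ?f h x \<partial>M) = ((\<integral>x. F (\<theta> + h) x \<partial>M) - (\<integral>x. F \<theta> x \<partial>M) - h \<bullet> (\<integral>x. DF \<theta> x \<partial>M)) / norm h" for h
    using int by simp
  show "?Q \<midarrow>0\<rightarrow> 0"
    unfolding tendsto_at_iff_sequentially comp_def
  proof (intro allI impI)
    fix X :: "nat \<Rightarrow> 'a" assume X0: "\<forall>i. X i \<in> UNIV - {0}" and X: "X \<longlonglongrightarrow> 0"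
    have "(\<lambda>i. \<theta> + X i) \<longlonglongrightarrow> \<theta>"
      using tendsto_add[OF tendsto_const X, of \<theta>] by simp
    then obtain B where B: "\<theta> \<in> cball 0 B" "\<And>i. \<theta> + X i \<in> cball 0 B"
      using tendsto_subset_cball by blast
    obtain g where g: "integrable M g" "\<And>\<theta> x. \<theta> \<in> cball 0 B \<Longrightarrow> x \<in> space M \<Longrightarrow> norm (DF \<theta> x) \<le> g x"
      using bound by metis
    have "(\<lambda>i. \<integral>x. ?f (X i) x \<partial>M) \<longlonglongrightarrow> (\<integral>x. 0 \<partial>M)"
    \<comment> \<open>One \<open>g\<close> bounds the increment of \<open>F\<close>, by the mean
      value inequality on the ball, and another one the linear term.\<close>
    proof (rule integral_dominated_convergence[where w="\<lambda>x. 2 * g x"])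
      show "(\<lambda>x. ?f (X i) x) \<in> borel_measurable M" for i
        using int by (auto intro!: borel_measurable_divide borel_measurable_diff
            borel_measurable_inner borel_measurable_integrable)
      show "AE x in M. (\<lambda>i. ?f (X i) x) \<longlonglongrightarrow> 0"
      proof (rule AE_I2)
        fix x assume "x \<in> space M"
        then have "(\<lambda>h. norm (?f h x)) \<midarrow>0\<rightarrow> 0"
          using der[of x \<theta>] unfolding gderiv_def has_derivative_at by simp
        then have "(\<lambda>i. norm (?f (X i) x)) \<longlonglongrightarrow> 0"
          using X0 X unfolding tendsto_at_iff_sequentially comp_def by blast
        then show "(\<lambda>i. ?f (X i) x) \<longlonglongrightarrow> 0" by (rule tendsto_norm_zero_cancel)
      qed
      show "AE x in M. norm (?f (X i) x) \<le> 2 * g x" for i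
      proof (rule AE_I2)
        fix x assume x: "x \<in> space M"
        have "\<bar>F (\<theta> + X i) x - F \<theta> x\<bar> \<le> g x * norm (\<theta> + X i - \<theta>)"
          using der[OF x] g(2)[OF _ x] B by (intro gderiv_difference_bound) auto
        moreover have "\<bar>X i \<bullet> DF \<theta> x\<bar> \<le> g x * norm (X i)"
          using Cauchy_Schwarz_ineq2[of "X i" "DF \<theta> x"]
            mult_left_mono[OF g(2)[OF B(1) x] norm_ge_zero[of "X i"]] by (simp add: mult.commute)
        ultimately have "\<bar>F (\<theta> + X i) x - F \<theta> x - X i \<bullet> DF \<theta> x\<bar> \<le> 2 * g x * norm (X i)"
          by simp
        then show "norm (?f (X i) x) \<le> 2 * g x"
          using X0 by (simp add: divide_le_eq)
      qed
    qed (use g in auto)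
    then have "(\<lambda>i. norm (\<integral>x. ?f (X i) x \<partial>M)) \<longlonglongrightarrow> 0"
      using tendsto_norm_zero by fastforce
    then show "(\<lambda>i. ?Q (X i)) \<longlonglongrightarrow> 0"
      unfolding eq norm_divide by simp
  qed
qed

lemma integrable_mult_bounded:
  fixes G :: "'x \<Rightarrow> 'b::{banach, second_countable_topology}"
  assumes "integrable M w" "G \<in> borel_measurable M" "\<And>x. x \<in> space M \<Longrightarrow> norm (G x) \<le> C"
  shows "integrable M (\<lambda>x. w x *\<^sub>R G x)"
proof (rule Bochner_Integration.integrable_bound)
  show "integrable M (\<lambda>x. C * w x)" using assms by simp
  show "AE x in M. norm (w x *\<^sub>R G x) \<le> norm (C * w x)"
  proof (rule AE_I2)
    fix x assume "x \<in> space M"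
    then have "norm (G x) \<le> \<bar>C\<bar>" using assms(3)[of x] by linarith
    then show "norm (w x *\<^sub>R G x) \<le> norm (C * w x)"
      using mult_right_mono[of "norm (G x)" "\<bar>C\<bar>" "\<bar>w x\<bar>"] by (simp add: abs_mult mult.commute)
  qed
qed (use assms in \<open>auto intro: borel_measurable_scaleR\<close>)

lemma tendsto_integral_bounded:
  fixes G :: "nat \<Rightarrow> 'x \<Rightarrow> 'b::{banach, second_countable_topology}"
  assumes w: "integrable M w" and G: "\<And>n. G n \<in> borel_measurable M" "H \<in> borel_measurable M"
    and C: "\<And>n x. x \<in> space M \<Longrightarrow> norm (G n x) \<le> C"
    and lim: "\<And>x. x \<in> space M \<Longrightarrow> (\<lambda>n. G n x) \<longlonglongrightarrow> H x"
  shows "(\<lambda>n. \<integral>x. w x *\<^sub>R G n x \<partial>M) \<longlonglongrightarrow> (\<integral>x. w x *\<^sub>R H x \<partial>M)"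
proof (rule integral_dominated_convergence[where w="\<lambda>x. \<bar>w x\<bar> * C"])
  show "AE x in M. norm (w x *\<^sub>R G n x) \<le> \<bar>w x\<bar> * C" for n
    using C by (intro AE_I2) (simp add: mult_left_mono)
  show "AE x in M. (\<lambda>n. w x *\<^sub>R G n x) \<longlonglongrightarrow> w x *\<^sub>R H x"
    using lim by (intro AE_I2 tendsto_scaleR) auto
qed (use w G in \<open>auto intro!: borel_measurable_scaleR\<close>)

lemma tame_integrable:
  fixes F :: "enat \<Rightarrow> 'a::euclidean_space \<Rightarrow> 'x \<Rightarrow> real"
  assumes "tame e M F" "integrable M w"
  shows "integrable M (\<lambda>x. w x * F r \<theta> x)"
proof -
  obtain DF where D: "tame_with e M F DF" using assms by (auto simp: tame_def)
  obtain C where C: "\<And>r \<theta>' x. \<theta>' \<in> cball 0 (norm \<theta>) \<Longrightarrow> x \<in> space M \<Longrightarrow> \<bar>F r \<theta>' x\<bar> \<le> C"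
    using tame_with_bound[OF D] by metis
  show ?thesis
    using integrable_mult_bounded[OF assms(2) tame_withD(1)[OF D, of r \<theta>], of C] C[of \<theta>] by simp
qed

text \<open>The weight \<open>w\<close> makes room for the unbounded target: it will be a component
  of \<open>f\<close> in the cross term of the loss, and the constant 1 elsewhere. The flag drops to
  \<open>False\<close> because the index from which equality holds may depend on the input. The
  result is kept as a family on \<open>M\<close>, constant in the input, so that it can be combined
  with other tame families.\<close>

lemma tame_integral:
  fixes F :: "enat \<Rightarrow> 'a::euclidean_space \<Rightarrow> 'x \<Rightarrow> real"
  assumes "tame e M F" "integrable M w"
  shows "tame False M (\<lambda>r \<theta> _. \<integral>x. w x * F r \<theta> x \<partial>M)"
proof -
  obtain DF where D: "tame_with e M F DF" using assms by (auto simp: tame_def)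
  note D1 = tame_withD[OF D]
  have ball: "\<theta> \<in> cball 0 (norm \<theta>)" for \<theta> :: 'a
    by simp
  have int: "integrable M (\<lambda>x. w x *\<^sub>R DF r \<theta> x)" for r \<theta>
    using tame_with_bound[OF D, of "norm \<theta>"] integrable_mult_bounded[OF assms(2) D1(2)] ball[of \<theta>]
    by metis
  show ?thesis
    unfolding tame_def tame_with_def
  proof (intro exI[of _ "\<lambda>r \<theta> _. \<integral>x. w x *\<^sub>R DF r \<theta> x \<partial>M"] conjI allI ballI)
    fix n \<theta>
    show "GDERIV (\<lambda>\<theta>. \<integral>x. w x * F (enat n) \<theta> x \<partial>M) \<theta> :> (\<integral>x. w x *\<^sub>R DF (enat n) \<theta> x \<partial>M)"
    proof (rule gderiv_integral)
      show "GDERIV (\<lambda>\<theta>. w x * F (enat n) \<theta> x) \<theta> :> w x *\<^sub>R DF (enat n) \<theta> x" if "x \<in> space M" for \<theta> x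
        using GDERIV_mult[OF GDERIV_const D1(3)[OF that]] by simp
      fix B
      obtain C where C: "\<And>r \<theta> x. \<theta> \<in> cball 0 B \<Longrightarrow> x \<in> space M \<Longrightarrow> norm (DF r \<theta> x) \<le> C"
        using tame_with_bound[OF D] by metis
      show "\<exists>g. integrable M g \<and> (\<forall>\<theta>\<in>cball 0 B. \<forall>x\<in>space M. norm (w x *\<^sub>R DF (enat n) \<theta> x) \<le> g x)"
        using assms(2) C by (intro exI[of _ "\<lambda>x. \<bar>w x\<bar> * C"]) (auto intro!: mult_left_mono)
    qed (use int tame_integrable[OF assms] in auto)
  next
    fix n
    show "continuous_on UNIV (\<lambda>\<theta>. \<integral>x. w x *\<^sub>R DF (enat n) \<theta> x \<partial>M)"
      unfolding continuous_on_sequentially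
    proof (clarsimp simp: comp_def)
      fix X :: "nat \<Rightarrow> 'a" and \<theta> assume X: "X \<longlonglongrightarrow> \<theta>"
      then obtain B where B: "\<And>i. X i \<in> cball 0 B" using tendsto_subset_cball by blast
      obtain C where C: "\<And>r \<theta> x. \<theta> \<in> cball 0 B \<Longrightarrow> x \<in> space M \<Longrightarrow> norm (DF r \<theta> x) \<le> C"
        using tame_with_bound[OF D] by metis
      show "(\<lambda>i. \<integral>x. w x *\<^sub>R DF (enat n) (X i) x \<partial>M) \<longlonglongrightarrow> (\<integral>x. w x *\<^sub>R DF (enat n) \<theta> x \<partial>M)"
      proof (rule tendsto_integral_bounded[OF assms(2)])
        show "(\<lambda>i. DF (enat n) (X i) x) \<longlonglongrightarrow> DF (enat n) \<theta> x" if "x \<in> space M" for x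
          using D1(4)[OF that, of n] X by (auto simp: continuous_on_sequentially comp_def)
      qed (use D1(2) C[OF B] in auto)
    qed
  next
    fix B
    obtain C where C: "C \<ge> 0" "\<And>r \<theta> x. \<theta> \<in> cball 0 B \<Longrightarrow> x \<in> space M \<Longrightarrow> \<bar>F r \<theta> x\<bar> \<le> C"
      "\<And>r \<theta> x. \<theta> \<in> cball 0 B \<Longrightarrow> x \<in> space M \<Longrightarrow> norm (DF r \<theta> x) \<le> C"
      using tame_with_bound[OF D(1)] by metis
    \<comment> \<open>Polymorphic in the values of \<open>H\<close>, so that it serves the real
      values and the gradients alike.\<close>
    have gbd: "norm (\<integral>x. w x *\<^sub>R H x \<partial>M) \<le> (\<integral>x. \<bar>w x\<bar> * C \<partial>M)"
      if "\<And>x. x \<in> space M \<Longrightarrow> norm (H x) \<le> C" for H :: "'x \<Rightarrow> 'c::{banach, second_countable_topology}"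
    proof -
      have "(\<integral>x. norm (w x *\<^sub>R H x) \<partial>M) \<le> (\<integral>x. \<bar>w x\<bar> * C \<partial>M)"
        by (rule integral_mono') (use assms(2) that C(1) in \<open>auto intro!: mult_left_mono\<close>)
      then show ?thesis
        using integral_norm_bound[of M "\<lambda>x. w x *\<^sub>R H x"] by linarith
    qed
    show "\<exists>C. \<forall>r. \<forall>\<theta>\<in>cball 0 B. \<forall>x\<in>space M. \<bar>\<integral>x. w x * F r \<theta> x \<partial>M\<bar> \<le> C
        \<and> norm (\<integral>x. w x *\<^sub>R DF r \<theta> x \<partial>M) \<le> C"
      using gbd[of "F _ _"] gbd[of "DF _ _"] C by (intro exI[of _ "\<integral>x. \<bar>w x\<bar> * C \<partial>M"]) auto
  next
    fix \<theta>
    obtain C where C: "C \<ge> 0" "\<And>r x. x \<in> space M \<Longrightarrow> \<bar>F r \<theta> x\<bar> \<le> C"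
      "\<And>r x. x \<in> space M \<Longrightarrow> norm (DF r \<theta> x) \<le> C"
      using tame_with_bound[OF D(1), of "norm \<theta>"] ball[of \<theta>] by metis
    show "conv_to False (\<lambda>n. \<integral>x. w x * F (enat n) \<theta> x \<partial>M) (\<integral>x. w x * F \<infinity> \<theta> x \<partial>M)"
      using tendsto_integral_bounded[OF assms(2), of "\<lambda>n. F (enat n) \<theta>" "F \<infinity> \<theta>" C]
        C D1(1) conv_to_imp_tendsto[OF D1(5)] by (simp add: conv_to_def)
    show "conv_to False (\<lambda>n. \<integral>x. w x *\<^sub>R DF (enat n) \<theta> x \<partial>M) (\<integral>x. w x *\<^sub>R DF \<infinity> \<theta> x \<partial>M)"
      using tendsto_integral_bounded[OF assms(2), of "\<lambda>n. DF (enat n) \<theta>" "DF \<infinity> \<theta>" C]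
        C D1(2) conv_to_imp_tendsto[OF D1(6)] by (simp add: conv_to_def)
  qed auto
qed

section \<open>The chain rule along absolutely continuous curves\<close>

lemma absolutely_integrable_inner_continuous:
  fixes X g :: "real \<Rightarrow> 'a::euclidean_space"
  assumes "g absolutely_integrable_on {s..t}" "continuous_on {s..t} X"
  shows "(\<lambda>u. X u \<bullet> g u) absolutely_integrable_on {s..t}"
proof (rule absolutely_integrable_bounded_measurable_product[where h="(\<bullet>)", OF _ _ _ _ assms(1)])
  show "bilinear ((\<bullet>) :: 'a \<Rightarrow> 'a \<Rightarrow> real)"
    by (simp add: bilinear_conv_bounded_bilinear bounded_bilinear_inner)
  show "X \<in> borel_measurable (lebesgue_on {s..t})"
    using assms(2) by (intro continuous_imp_measurable_on_sets_lebesgue) auto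
  show "bounded (X ` {s..t})"
    using assms(2) by (simp add: compact_continuous_image compact_imp_bounded)
qed simp

lemma gderiv_mean_value:
  fixes F :: "'a::euclidean_space \<Rightarrow> real"
  assumes "\<And>p. GDERIV F p :> D p"
  obtains p where "p \<in> closed_segment x y" "F y - F x = D p \<bullet> (y - x)"
proof -
  have "((\<lambda>z. F (x + z *\<^sub>R (y - x))) has_derivative (\<lambda>h. h *\<^sub>R (y - x) \<bullet> D (x + z *\<^sub>R (y - x))))
      (at z within {0..1})" for z
    by (rule has_derivative_compose[where g=F])
      (use assms in \<open>auto simp: gderiv_def intro!: derivative_eq_intros\<close>)
  from mvt_very_simple[of 0 1, OF _ this] obtain z where
    "z \<in> {0..1}" "F y - F x = (y - x) \<bullet> D (x + z *\<^sub>R (y - x))"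
    by auto
  moreover have "x + z *\<^sub>R (y - x) = (1 - z) *\<^sub>R x + z *\<^sub>R y"
    by (simp add: algebra_simps)
  ultimately show thesis
    using that[of "x + z *\<^sub>R (y - x)"] by (auto simp: in_segment inner_commute)
qed

lemma continuous_on_of_increments:
  fixes c g :: "real \<Rightarrow> 'a::euclidean_space"
  assumes "g integrable_on {s..t}"
    and "\<And>u v. s \<le> u \<Longrightarrow> u \<le> v \<Longrightarrow> v \<le> t \<Longrightarrow> c v - c u = integral {u..v} g"
  shows "continuous_on {s..t} c"
proof (rule continuous_on_eq)
  show "continuous_on {s..t} (\<lambda>u. c s + integral {s..u} g)"
    by (intro continuous_intros indefinite_integral_continuous_1 assms)
  show "c s + integral {s..u} g = c u" if "u \<in> {s..t}" for u
    using assms(2)[of s u] that by (simp add: algebra_simps)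
qed

text \<open>
  The curve is only absolutely continuous. The defect \<open>E u v\<close> of the claimed identity is additive
  over adjacent intervals and, by the mean value theorem, locally at most \<open>\<epsilon>\<close> times the length
  of the curve, so bisection makes it vanish without differentiating the curve anywhere.
\<close>

lemma gderiv_chain_rule_integral:
  fixes F :: "'a::euclidean_space \<Rightarrow> real" and c g :: "real \<Rightarrow> 'a"
  assumes "s \<le> t" and g: "g absolutely_integrable_on {s..t}"
    and c: "\<And>u v. s \<le> u \<Longrightarrow> u \<le> v \<Longrightarrow> v \<le> t \<Longrightarrow> c v - c u = integral {u..v} g"
    and D: "\<And>p. GDERIV F p :> D p" "continuous_on UNIV D"
  shows "F (c t) - F (c s) = integral {s..t} (\<lambda>u. D (c u) \<bullet> g u)"
proof -
  have gi: "g integrable_on {s..t}" and ngi: "(\<lambda>u. norm (g u)) integrable_on {s..t}"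
    using g by (auto simp: absolutely_integrable_on_def)
  have cont: "continuous_on {s..t} c"
    using gi c by (rule continuous_on_of_increments)
  have "continuous_on {s..t} (\<lambda>u. D (c u))"
    using continuous_on_compose2[OF D(2) cont] by simp
  note ai = absolutely_integrable_inner_continuous[OF g this]
  then have hi: "(\<lambda>u. D (c u) \<bullet> g u) integrable_on {s..t}"
    by (auto simp: absolutely_integrable_on_def)
  define E where "E u v = F (c v) - F (c u) - integral {u..v} (\<lambda>u. D (c u) \<bullet> g u)" for u v
  have bound: "\<bar>E s t\<bar> \<le> \<epsilon> * integral {s..t} (\<lambda>u. norm (g u))" if "\<epsilon> > 0" for \<epsilon>
  proof -
    \<comment> \<open>Bisection also tests small intervals that stick out of \<open>{s..t}\<close>;
      the guard makes the claim void for them.\<close>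
    define Q where "Q u v \<longleftrightarrow>
      (s \<le> u \<and> v \<le> t \<longrightarrow> \<bar>E u v\<bar> \<le> \<epsilon> * integral {u..v} (\<lambda>u. norm (g u)))" for u v
    have "Q s t"
      using \<open>s \<le> t\<close>
    proof (induction rule: Bolzano)
      case (trans u v w)
      show ?case
        unfolding Q_def
      proof safe
        assume uw: "s \<le> u" "w \<le> t"
        have sub: "{u..w} \<subseteq> {s..t}" using uw by auto
        have "integral {u..w} (\<lambda>u. D (c u) \<bullet> g u) = integral {u..v} (\<lambda>u. D (c u) \<bullet> g u) + integral {v..w} (\<lambda>u. D (c u) \<bullet> g u)"
          by (rule Henstock_Kurzweil_Integration.integral_combine[symmetric]) (use trans integrable_on_subinterval[OF hi sub] in auto)
        then have "E u w = E u v + E v w" by (simp add: E_def)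
        moreover have "integral {u..w} (\<lambda>u. norm (g u)) = integral {u..v} (\<lambda>u. norm (g u)) + integral {v..w} (\<lambda>u. norm (g u))"
          by (rule Henstock_Kurzweil_Integration.integral_combine[symmetric]) (use trans integrable_on_subinterval[OF ngi sub] in auto)
        moreover have "\<bar>E u v\<bar> \<le> \<epsilon> * integral {u..v} (\<lambda>u. norm (g u))"
          "\<bar>E v w\<bar> \<le> \<epsilon> * integral {v..w} (\<lambda>u. norm (g u))"
          using trans uw unfolding Q_def by auto
        ultimately show "\<bar>E u w\<bar> \<le> \<epsilon> * integral {u..w} (\<lambda>u. norm (g u))"
          by (simp add: distrib_left)
      qed
    next
      case (local x)
      have "continuous (at (c x)) D" using D(2) by (simp add: continuous_on_eq_continuous_at)
      then obtain \<eta> where \<eta>: "\<eta> > 0" "\<And>p. dist p (c x) < \<eta> \<Longrightarrow> dist (D p) (D (c x)) < \<epsilon> / 2"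
        using \<open>\<epsilon> > 0\<close> unfolding continuous_at_eps_delta by (metis half_gt_zero dist_commute)
      obtain d where d: "d > 0" "\<And>u. u \<in> {s..t} \<Longrightarrow> dist u x < d \<Longrightarrow> dist (c u) (c x) < \<eta>"
        using cont local \<eta>(1) unfolding continuous_on_iff by (metis atLeastAtMost_iff)
      show ?case
        unfolding Q_def
      proof (intro exI[of _ d] conjI allI impI \<open>d > 0\<close>)
        fix u v assume uv: "u \<le> x \<and> x \<le> v \<and> v - u < d" and st: "s \<le> u \<and> v \<le> t"
        have near: "c w \<in> ball (c x) \<eta>" if "w \<in> {u..v}" for w
          using d(2)[of w] that uv st by (auto simp: dist_real_def dist_commute)
        obtain p where p: "p \<in> closed_segment (c u) (c v)" "F (c v) - F (c u) = D p \<bullet> (c v - c u)"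
          using gderiv_mean_value[OF D(1)] by blast
        \<comment> \<open>The intermediate point lies on the chord and possibly off the curve;
          convexity of the ball keeps it close to \<open>c x\<close> all the same.\<close>
        have "closed_segment (c u) (c v) \<subseteq> ball (c x) \<eta>"
          using near uv by (intro closed_segment_subset convex_ball) auto
        with p have "p \<in> ball (c x) \<eta>" by auto
        then have Dp: "dist (D p) (D (c x)) < \<epsilon> / 2" using \<eta>(2) by (simp add: dist_commute)
        have Dle: "norm (D p - D (c w)) \<le> \<epsilon>" if "w \<in> {u..v}" for w
        proof -
          have "dist (D (c w)) (D (c x)) < \<epsilon> / 2"
            using \<eta>(2) near[OF that] by (simp add: dist_commute)
          then have "dist (D p) (D (c w)) < \<epsilon>"
            using Dp dist_triangle2[of "D p" "D (c w)" "D (c x)"] by simp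
          then show ?thesis by (simp add: dist_norm)
        qed
        have sub: "{u..v} \<subseteq> {s..t}" using st by auto
        note gi' = integrable_on_subinterval[OF gi sub] and ngi' = integrable_on_subinterval[OF ngi sub]
          and hi' = integrable_on_subinterval[OF hi sub]
        have Dpi: "(\<lambda>w. D p \<bullet> g w) integrable_on {u..v}"
          using integrable_linear[OF gi' bounded_linear_inner_right[of "D p"]] by (simp add: comp_def)
        have "D p \<bullet> (c v - c u) = integral {u..v} (\<lambda>w. D p \<bullet> g w)"
          using c[of u v] uv st integral_linear[OF gi' bounded_linear_inner_right[of "D p"]]
          by (simp add: comp_def)
        \<comment> \<open>With the gradient frozen at \<open>p\<close>, the increment of
          \<open>F\<close> is itself an integral against \<open>g\<close>, so the defect only sees
          the oscillation of \<open>D\<close> near \<open>c x\<close>.\<close>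
        then have "E u v = integral {u..v} (\<lambda>w. (D p - D (c w)) \<bullet> g w)"
          using p(2) Dpi hi' by (simp add: E_def inner_diff_left Henstock_Kurzweil_Integration.integral_diff)
        also have "norm \<dots> \<le> integral {u..v} (\<lambda>w. \<epsilon> * norm (g w))"
        proof (rule Henstock_Kurzweil_Integration.integral_norm_bound_integral)
          show "(\<lambda>w. (D p - D (c w)) \<bullet> g w) integrable_on {u..v}"
            using Henstock_Kurzweil_Integration.integrable_diff[OF Dpi hi'] by (simp add: inner_diff_left)
          show "norm ((D p - D (c w)) \<bullet> g w) \<le> \<epsilon> * norm (g w)" if "w \<in> {u..v}" for w
            using Cauchy_Schwarz_ineq2[of "D p - D (c w)" "g w"]
              mult_right_mono[OF Dle[OF that] norm_ge_zero[of "g w"]] by simp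
        qed (use ngi' in \<open>auto intro: integrable_on_mult_right\<close>)
        finally show "\<bar>E u v\<bar> \<le> \<epsilon> * integral {u..v} (\<lambda>u. norm (g u))" by simp
      qed
    qed
    then show ?thesis by (simp add: Q_def)
  qed
  have "E s t = 0"
  proof (rule ccontr)
    assume "E s t \<noteq> 0"
    define I where "I = integral {s..t} (\<lambda>u. norm (g u))"
    have "I \<ge> 0" unfolding I_def by (rule Henstock_Kurzweil_Integration.integral_nonneg[OF ngi]) auto
    \<comment> \<open>The value of \<epsilon> that refutes a nonzero defect; adding 1 avoids
      division by zero and makes the inequality strict.\<close>
    then have "\<bar>E s t\<bar> / (I + 1) * I < \<bar>E s t\<bar>"
      using \<open>E s t \<noteq> 0\<close> by (simp add: field_simps)
    moreover have "\<bar>E s t\<bar> \<le> \<bar>E s t\<bar> / (I + 1) * I"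
      unfolding I_def[symmetric]
      using bound[of "\<bar>E s t\<bar> / (I + 1)"] \<open>I \<ge> 0\<close> \<open>E s t \<noteq> 0\<close> by (simp add: I_def)
    ultimately show False by simp
  qed
  then show ?thesis by (simp add: E_def)
qed

section \<open>Networks and their losses\<close>

text \<open>The series counts the indices from \<open>N\<close> on at which \<open>u\<close> is
  positive. Once this count is below 1, its first term, which belongs to \<open>N\<close> itself,
  must vanish.\<close>

lemma eventually_equal_of_limsup:
  fixes u :: "nat \<Rightarrow> real"
  assumes "limsup (\<lambda>N. \<Sum>r. indicator {0<..} (u (N + r)) :: ennreal) = 0"
  shows "\<forall>\<^sub>F n in sequentially. u n \<le> 0"
proof -
  have "limsup (\<lambda>N. \<Sum>r. indicator {0<..} (u (N + r)) :: ennreal) < 1"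
    using assms by simp
  then have "\<forall>\<^sub>F N in sequentially. (\<Sum>r. indicator {0<..} (u (N + r)) :: ennreal) < 1"
    by (rule Limsup_lessD)
  then show ?thesis
  proof eventually_elim
    case (elim N)
    from ennreal_suminf_lessD[OF this, of 0] show ?case
      by (cases "0 < u N") (simp_all add: indicator_def)
  qed
qed

lemma SUP_SUP_ereal_bound:
  fixes h :: "'i \<Rightarrow> 'j \<Rightarrow> real"
  assumes "(SUP i\<in>I. SUP j\<in>J. ereal (h i j)) < \<infinity>"
  obtains C where "\<And>i j. i \<in> I \<Longrightarrow> j \<in> J \<Longrightarrow> h i j \<le> C"
proof -
  obtain m :: nat where m: "(SUP i\<in>I. SUP j\<in>J. ereal (h i j)) < ereal (real m)"
    using assms less_PInf_Ex_of_nat by (metis less_irrefl)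
  have "h i j \<le> real m" if "i \<in> I" "j \<in> J" for i j
  proof -
    have "ereal (h i j) \<le> (SUP i\<in>I. SUP j\<in>J. ereal (h i j))"
      using that by (auto intro: SUP_upper2)
    then have "ereal (h i j) < ereal (real m)"
      using m by (rule le_less_trans)
    then show ?thesis by simp
  qed
  then show thesis by (rule that)
qed

text \<open>
  The approximations are numbered from 1, and \<open>R 0\<close> is arbitrary; shifting by \<^const>\<open>eSuc\<close> removes
  it and fixes \<open>\<infinity>\<close>.
\<close>

lemma activationI:
  fixes R :: "enat \<Rightarrow> real \<Rightarrow> real"
  assumes C1: "\<forall>r::nat. r \<ge> 1 \<longrightarrow> R (enat r) C1_differentiable_on UNIV"
    and Rinf: "\<forall>x. R \<infinity> x = max x 0"
    and SUP: "\<forall>x. (SUP r\<in>{1::nat..}. SUP y\<in>{-\<bar>x\<bar>..\<bar>x\<bar>}. ereal \<bar>deriv (R (enat r)) y\<bar>) < \<infinity>"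
    and limsup: "\<forall>x. limsup (\<lambda>N. \<Sum>r. indicator {0<..}
            (\<bar>R (enat (N + r)) x - R \<infinity> x\<bar>
              + \<bar>deriv (R (enat (N + r))) x - indicator {0<..} x\<bar>) :: ennreal) = 0"
  shows "activation (\<lambda>r. R (eSuc r)) (\<lambda>r. if r = \<infinity> then indicator {0<..} else deriv (R (eSuc r)))"
proof -
  have der: "DERIV (R (enat (Suc n))) y :> deriv (R (enat (Suc n))) y"
    and cont: "continuous_on UNIV (deriv (R (enat (Suc n))))" for n y
  proof -
    obtain D where D: "\<And>x. (R (enat (Suc n)) has_vector_derivative D x) (at x)" "continuous_on UNIV D"
      using C1[rule_format, of "Suc n"] by (auto simp: C1_differentiable_on_def)
    then have *: "DERIV (R (enat (Suc n))) x :> D x" for x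
      by (simp add: has_real_derivative_iff_has_vector_derivative)
    then have "deriv (R (enat (Suc n))) = D"
      by (auto intro: DERIV_imp_deriv)
    then show "DERIV (R (enat (Suc n))) y :> deriv (R (enat (Suc n))) y"
      "continuous_on UNIV (deriv (R (enat (Suc n))))"
      using * D(2) by auto
  qed
  have ev: "\<forall>\<^sub>F n in sequentially. R (enat (Suc n)) y = R \<infinity> y \<and>
      deriv (R (enat (Suc n))) y = indicator {0<..} y" for y
  proof -
    have "\<forall>\<^sub>F n in sequentially. \<bar>R (enat (Suc n)) y - R \<infinity> y\<bar>
              + \<bar>deriv (R (enat (Suc n))) y - indicator {0<..} y\<bar> \<le> 0"
      using eventually_equal_of_limsup[OF limsup[rule_format, of y]]
      by (subst (asm) eventually_sequentially_Suc[symmetric])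
    then show ?thesis
      by eventually_elim linarith
  qed
  \<comment> \<open>The hypotheses bound derivatives only. Bounds on the values need one base point,
    and the values at 0 are bounded because they are eventually constant.\<close>
  have "(\<lambda>n. R (enat (Suc n)) 0) \<longlonglongrightarrow> R \<infinity> 0"
    by (rule tendsto_eventually) (use ev[of 0] in \<open>auto elim: eventually_mono\<close>)
  then have "Bseq (\<lambda>n. R (enat (Suc n)) 0)"
    using convergent_imp_Bseq convergentI by blast
  then obtain K where K: "\<And>n. \<bar>R (enat (Suc n)) 0\<bar> \<le> K"
    by (auto simp: Bseq_def)
  show ?thesis
    unfolding activation_def
  proof (intro conjI allI)
    fix B :: real
    obtain C where C: "\<And>r y. r \<in> {1::nat..} \<Longrightarrow> y \<in> {-\<bar>B\<bar>..\<bar>B\<bar>} \<Longrightarrow> \<bar>deriv (R (enat r)) y\<bar> \<le> C"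
      using SUP_SUP_ereal_bound[OF SUP[rule_format, of B]] by metis
    have C': "\<bar>deriv (R (enat (Suc n))) y\<bar> \<le> C" if "\<bar>y\<bar> \<le> B" for n y
      by (rule C) (use that in \<open>simp_all only: atLeast_iff atLeastAtMost_iff, linarith+\<close>)
    have val: "\<bar>R (enat (Suc n)) y\<bar> \<le> K + \<bar>C\<bar> * \<bar>B\<bar>" if "\<bar>y\<bar> \<le> B" for n y
    proof -
      have "\<bar>R (enat (Suc n)) y - R (enat (Suc n)) 0\<bar> \<le> C * norm (y - 0)"
        by (rule gderiv_difference_bound[where D="deriv (R (enat (Suc n)))" and B=B])
          (use der C' that in auto)
      also have "\<dots> \<le> \<bar>C\<bar> * \<bar>B\<bar>"
        using that by (intro mult_mono) auto
      finally show ?thesis using K[of n] by linarith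
    qed
    show "\<exists>C. \<forall>r y. \<bar>y\<bar> \<le> B \<longrightarrow> \<bar>R (eSuc r) y\<bar> \<le> C \<and>
        \<bar>(if r = \<infinity> then indicator {0<..} else deriv (R (eSuc r))) y\<bar> \<le> C"
    proof (intro exI allI impI)
      fix r :: enat and y assume y: "\<bar>y\<bar> \<le> B"
      have nn: "K \<ge> 0" "\<bar>C\<bar> * \<bar>B\<bar> \<ge> 0" using K[of 0] by auto
      \<comment> \<open>The constant adds up four bounds:
        \<open>K + \<bar>C\<bar> * \<bar>B\<bar>\<close> for the values of the approximations,
        \<open>\<bar>C\<bar>\<close> for their derivatives, \<open>\<bar>B\<bar>\<close> for
        \<open>max y 0\<close> and 1 for the indicator.\<close>
      show "\<bar>R (eSuc r) y\<bar> \<le> K + \<bar>C\<bar> * \<bar>B\<bar> + \<bar>C\<bar> + \<bar>B\<bar> + 1 \<and>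
        \<bar>(if r = \<infinity> then indicator {0<..} else deriv (R (eSuc r))) y\<bar> \<le> K + \<bar>C\<bar> * \<bar>B\<bar> + \<bar>C\<bar> + \<bar>B\<bar> + 1"
      proof (cases r)
        case (enat n)
        then show ?thesis
          using val[OF y, of n] C'[OF y, of n] nn by (simp add: eSuc_enat) linarith
      next
        case infinity
        have "\<bar>indicator {0<..} y\<bar> \<le> (1::real)" "\<bar>max y 0\<bar> \<le> \<bar>B\<bar>"
          using y by (auto simp: indicator_def)
        then show ?thesis
          using nn infinity Rinf by (simp only: eSuc_infinity if_True refl) linarith
      qed
    qed
  next
    fix r
    have "R \<infinity> = (\<lambda>x. max x 0)" using Rinf by auto
    moreover have "continuous_on UNIV (R (enat (Suc n)))" for n
      using DERIV_isCont[OF der] by (simp add: continuous_at_imp_continuous_on)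
    ultimately show "R (eSuc r) \<in> borel_measurable borel"
      by (cases r) (auto simp: eSuc_enat intro: borel_measurable_continuous_onI)
    show "(if r = \<infinity> then indicator {0<..} else deriv (R (eSuc r))) \<in> borel_measurable borel"
      using cont by (cases r) (auto simp: eSuc_enat intro: borel_measurable_continuous_onI)
  qed (use der cont ev in \<open>auto simp: eSuc_enat\<close>)
qed

section \<open>Network outputs and losses as tame families on the cube\<close>

lemma space_borel_cube:
  assumes "sets \<mu> = sets (borel_cube n a b)"
  shows "space \<mu> = cube n a b"
  using sets_eq_imp_space_eq[OF assms]
  by (auto simp: borel_cube_def space_restrict_space space_PiM cube_def)

lemma coordinate_borel_cube:
  assumes "sets \<mu> = sets (borel_cube n a b)" "i \<in> {1..n}"
  shows "(\<lambda>x. x i) \<in> borel_measurable \<mu>" "x \<in> space \<mu> \<Longrightarrow> \<bar>x i\<bar> \<le> \<bar>a\<bar> + \<bar>b\<bar>"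
proof -
  have "(\<lambda>x. x i) \<in> borel_measurable (borel_cube n a b)"
    unfolding borel_cube_def using assms(2)
    by (intro measurable_restrict_space1 measurable_component_singleton)
  then show "(\<lambda>x. x i) \<in> borel_measurable \<mu>"
    by (simp add: measurable_cong_sets[OF assms(1) refl])
  show "\<bar>x i\<bar> \<le> \<bar>a\<bar> + \<bar>b\<bar>" if "x \<in> space \<mu>"
    using that assms(2) space_borel_cube[OF assms(1)] by (auto simp: cube_def dest!: PiE_mem)
qed

lemma tame_affine_map:
  fixes idx :: "nat \<Rightarrow> 'd::finite"
  assumes "\<And>j. j \<in> {1..l (k - 1)} \<Longrightarrow> tame e M (\<lambda>r \<theta> x. X r \<theta> x j)" "i \<in> {1..l k}"
  shows "tame e M (\<lambda>r \<theta> x. affine_map idx l k \<theta> (X r \<theta> x) i)"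
proof -
  have nth: "tame e M (\<lambda>r \<theta> x. \<theta> $ m)" for m :: 'd
    using tame_inner[of e M "axis m (1::real)"] by (simp add: inner_axis)
  have "tame e M (\<lambda>r \<theta> x. bias idx l k \<theta> i + (\<Sum>j=1..l (k - 1). weight idx l k \<theta> i j * X r \<theta> x j))"
    unfolding bias_def weight_def
    by (intro tame_add tame_sum tame_mult nth assms finite_atLeastAtMost)
  then show ?thesis
    by (rule tame_cong) (use assms(2) in \<open>simp add: affine_map_def\<close>)
qed

text \<open>Below layer \<open>L\<close> the indicator in front of the centring integral vanishes,
  so the induction meets only affine maps and activations, and the flag stays
  \<open>True\<close>.\<close>

lemma tame_realization:
  fixes idx :: "nat \<Rightarrow> 'd::finite"
  assumes act: "activation S S'" and \<mu>: "sets \<mu> = sets (borel_cube (l 0) a b)"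
    and "Suc k < L" "i \<in> {1..l (Suc k)}"
  shows "tame True \<mu> (\<lambda>r \<theta> x. realization idx L l \<mu> (S r) \<theta> (Suc k) x i)"
  using assms(3,4)
proof (induction k arbitrary: i)
  case 0
  have "tame True \<mu> (\<lambda>r \<theta> x. affine_map idx l 1 \<theta> x i)"
    by (rule tame_affine_map)
      (use 0 coordinate_borel_cube[OF \<mu>] in \<open>auto intro: tame_const\<close>)
  then show ?case by simp
next
  case (Suc k)
  have "tame True \<mu> (\<lambda>r \<theta> x. affine_map idx l (Suc (Suc k)) \<theta>
      (\<lambda>i\<in>{1..l (Suc k)}. multi_act (l (Suc k)) (S r) (realization idx L l \<mu> (S r) \<theta> (Suc k) x) i) i)"
  proof (rule tame_affine_map)
    fix j assume j: "j \<in> {1..l (Suc (Suc k) - 1)}"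
    have "tame True \<mu> (\<lambda>r \<theta> x. S r (realization idx L l \<mu> (S r) \<theta> (Suc k) x j))"
      using Suc j by (intro tame_compose[OF act]) auto
    then show "tame True \<mu> (\<lambda>r \<theta> x. (\<lambda>i\<in>{1..l (Suc k)}.
        multi_act (l (Suc k)) (S r) (realization idx L l \<mu> (S r) \<theta> (Suc k) x) i) j)"
      by (rule tame_cong) (use j in \<open>simp add: multi_act_def\<close>)
  qed (use Suc in auto)
  with Suc.prems show ?case
    by simp
qed

lemma tame_realization_last:
  fixes idx :: "nat \<Rightarrow> 'd::finite"
  assumes act: "activation S S'" and \<mu>: "sets \<mu> = sets (borel_cube (l 0) a b)" "finite_measure \<mu>"
    and "L \<ge> 2" "i \<in> {1..l L}"
  shows "tame False \<mu> (\<lambda>r \<theta> x. realization idx L l \<mu> (S r) \<theta> L x i)"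
proof -
  obtain k where L: "L = Suc (Suc k)"
    using \<open>L \<ge> 2\<close> by (metis add_2_eq_Suc le_Suc_ex)
  interpret finite_measure \<mu> by fact
  have "tame False \<mu> (\<lambda>r \<theta> x. affine_map idx l L \<theta>
      (\<lambda>i\<in>{1..l (Suc k)}. multi_act (l (Suc k)) (S r) (realization idx L l \<mu> (S r) \<theta> (Suc k) x) i
         - (\<integral>y. multi_act (l (Suc k)) (S r) (realization idx L l \<mu> (S r) \<theta> (Suc k) y) i \<partial>\<mu>)) i)"
  proof (rule tame_affine_map)
    fix j assume j: "j \<in> {1..l (L - 1)}"
    let ?F = "\<lambda>r \<theta> x. S r (realization idx L l \<mu> (S r) \<theta> (Suc k) x j)"
    have F: "tame True \<mu> ?F"
      using j L \<mu>(1) by (intro tame_compose[OF act] tame_realization[OF act, where a=a and b=b]) auto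
    \<comment> \<open>The factor -1 and the weight 1 bring the centring into the form of the closure
      properties; the weight is integrable since the measure is finite.\<close>
    have "tame False \<mu> (\<lambda>r \<theta> x. ?F r \<theta> x + (-1) * (\<integral>y. 1 * ?F r \<theta> y \<partial>\<mu>))"
      by (intro tame_add tame_weaken[OF F] tame_cmult tame_integral[OF F]) simp
    then show "tame False \<mu> (\<lambda>r \<theta> x. (\<lambda>i\<in>{1..l (Suc k)}.
        multi_act (l (Suc k)) (S r) (realization idx L l \<mu> (S r) \<theta> (Suc k) x) i
         - (\<integral>y. multi_act (l (Suc k)) (S r) (realization idx L l \<mu> (S r) \<theta> (Suc k) y) i \<partial>\<mu>)) j)"
      by (rule tame_cong) (use j L in \<open>simp add: multi_act_def\<close>)
  qed (use assms in auto)
  then show ?thesis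
    by (simp add: L)
qed

text \<open>The integrand itself need not be tame, as \<open>f\<close> may be unbounded. Expanding
  the square leaves \<open>f\<close> only as the weight of an integral and in a term that is
  constant in the parameter.\<close>

lemma tame_loss:
  fixes idx :: "nat \<Rightarrow> 'd::finite"
  assumes act: "activation S S'" and \<mu>: "sets \<mu> = sets (borel_cube (l 0) a b)" "finite_measure \<mu>"
    and "L \<ge> 2" and f: "f \<in> measurable (borel_cube (l 0) a b) (\<Pi>\<^sub>M i\<in>{1..l L}. borel)"
    and loss: "\<And>r \<theta>. has_bochner_integral \<mu>
            (\<lambda>x. (L2_set (\<lambda>i. realization idx L l \<mu> (S r) \<theta> L x i - f x i) {1..l L})\<^sup>2) (loss r \<theta>)"
  shows "tame False \<mu> (\<lambda>r \<theta> x. loss r \<theta>)"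
proof -
  interpret finite_measure \<mu> by fact
  define N where "N i r \<theta> x = realization idx L l \<mu> (S r) \<theta> L x i" for i r \<theta> x
  have N: "tame False \<mu> (N i)" if "i \<in> {1..l L}" for i
    using tame_realization_last[OF act \<mu> \<open>L \<ge> 2\<close> that] by (simp add: N_def[abs_def])
  have NN: "tame False \<mu> (\<lambda>r \<theta> x. N i r \<theta> x * N i r \<theta> x)" if "i \<in> {1..l L}" for i
    using N[OF that] N[OF that] by (rule tame_mult)
  have one: "integrable \<mu> (\<lambda>_. 1 :: real)" by simp
  have Nm: "N i r \<theta> \<in> borel_measurable \<mu>" if "i \<in> {1..l L}" for i r \<theta>
    using N[OF that] by (auto simp: tame_def dest: tame_withD(1))
  have fm: "(\<lambda>x. f x i) \<in> borel_measurable \<mu>" if "i \<in> {1..l L}" for i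
    using measurable_compose[OF f measurable_component_singleton[OF that]]
    by (simp add: measurable_cong_sets[OF \<mu>(1) refl])
  have sq: "(L2_set (\<lambda>i. realization idx L l \<mu> (S r) \<theta> L x i - f x i) {1..l L})\<^sup>2
      = (\<Sum>i=1..l L. (N i r \<theta> x - f x i)\<^sup>2)" for r \<theta> x
    by (simp add: L2_set_def N_def sum_nonneg)
  \<comment> \<open>Square integrability comes from the loss at a single index and parameter,
    together with the boundedness of the network there.\<close>
  have f2: "integrable \<mu> (\<lambda>x. (f x i)\<^sup>2)" if i: "i \<in> {1..l L}" for i
  proof (rule Bochner_Integration.integrable_bound)
    show "integrable \<mu> (\<lambda>x. 2 * (\<Sum>i=1..l L. (N i 0 0 x - f x i)\<^sup>2) + 2 * (N i 0 0 x * N i 0 0 x))"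
    proof (intro Bochner_Integration.integrable_add integrable_mult_right)
      show "integrable \<mu> (\<lambda>x. \<Sum>i=1..l L. (N i 0 0 x - f x i)\<^sup>2)"
        using loss[of 0 0] unfolding sq by (rule integrable.intros)
      show "integrable \<mu> (\<lambda>x. N i 0 0 x * N i 0 0 x)"
        using tame_integrable[OF NN[OF i] one, of 0 0] by simp
    qed
    show "AE x in \<mu>. norm ((f x i)\<^sup>2)
        \<le> norm (2 * (\<Sum>i=1..l L. (N i 0 0 x - f x i)\<^sup>2) + 2 * (N i 0 0 x * N i 0 0 x))"
    proof (rule AE_I2)
      fix x
      have "(N i 0 0 x - f x i)\<^sup>2 \<le> (\<Sum>i=1..l L. (N i 0 0 x - f x i)\<^sup>2)"
        using i by (intro member_le_sum) auto
      \<comment> \<open>The right side minus the left side is the square of twice the network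
        component minus \<open>f x i\<close>.\<close>
      moreover have "(f x i)\<^sup>2 \<le> 2 * (N i 0 0 x - f x i)\<^sup>2 + 2 * (N i 0 0 x * N i 0 0 x)"
        using zero_le_power2[of "2 * N i 0 0 x - f x i"] by (simp add: power2_eq_square algebra_simps)
      ultimately show "norm ((f x i)\<^sup>2)
        \<le> norm (2 * (\<Sum>i=1..l L. (N i 0 0 x - f x i)\<^sup>2) + 2 * (N i 0 0 x * N i 0 0 x))"
        by simp
    qed
  qed (use fm[OF i] in simp)
  \<comment> \<open>Needed because \<open>f\<close> is the weight of the cross term; the measure
    being finite, it follows from square integrability.\<close>
  have f1: "integrable \<mu> (\<lambda>x. f x i)" if i: "i \<in> {1..l L}" for i
  proof (rule Bochner_Integration.integrable_bound)
    show "integrable \<mu> (\<lambda>x. 1 + (f x i)\<^sup>2)"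
      using f2[OF i] by simp
    have "\<bar>y\<bar> \<le> 1 + y\<^sup>2" for y :: real
      using zero_le_power2[of "\<bar>y\<bar> - 1/2"] by (simp add: power2_eq_square algebra_simps)
    then show "AE x in \<mu>. norm (f x i) \<le> norm (1 + (f x i)\<^sup>2)"
      by (intro AE_I2) (simp add: abs_of_nonneg)
  qed (use fm[OF i] in simp)
  have "loss r \<theta> = (\<Sum>i=1..l L. (\<integral>x. 1 * (N i r \<theta> x * N i r \<theta> x) \<partial>\<mu>)
      + ((-2) * (\<integral>x. f x i * N i r \<theta> x \<partial>\<mu>) + (\<integral>x. (f x i)\<^sup>2 \<partial>\<mu>)))" for r \<theta>
  proof -
    have i1: "integrable \<mu> (\<lambda>x. (N i r \<theta> x * N i r \<theta> x))"
      and i2: "integrable \<mu> (\<lambda>x. f x i * N i r \<theta> x)" if "i \<in> {1..l L}" for i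
      using tame_integrable[OF NN[OF that] one] tame_integrable[OF N[OF that] f1[OF that]] by auto
    have "loss r \<theta> = (\<integral>x. (\<Sum>i=1..l L. (N i r \<theta> x * N i r \<theta> x)
        + ((-2) * (f x i * N i r \<theta> x) + (f x i)\<^sup>2)) \<partial>\<mu>)"
      using loss[of r \<theta>] unfolding sq
      by (simp add: has_bochner_integral_iff power2_eq_square algebra_simps sum_distrib_left)
    also have "\<dots> = (\<Sum>i=1..l L. (\<integral>x. N i r \<theta> x * N i r \<theta> x
        + ((-2) * (f x i * N i r \<theta> x) + (f x i)\<^sup>2) \<partial>\<mu>))"
      using i1 i2 f2
      by (intro Bochner_Integration.integral_sum Bochner_Integration.integrable_add integrable_mult_right)
    also have "\<dots> = (\<Sum>i=1..l L. (\<integral>x. 1 * (N i r \<theta> x * N i r \<theta> x) \<partial>\<mu>)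
      + ((-2) * (\<integral>x. f x i * N i r \<theta> x \<partial>\<mu>) + (\<integral>x. (f x i)\<^sup>2 \<partial>\<mu>)))"
      using i1 i2 f2 by (intro sum.cong refl) simp
    finally show ?thesis .
  qed
  moreover have "tame False \<mu> (\<lambda>r \<theta> x. \<Sum>i=1..l L. (\<integral>x. 1 * (N i r \<theta> x * N i r \<theta> x) \<partial>\<mu>)
      + ((-2) * (\<integral>x. f x i * N i r \<theta> x \<partial>\<mu>) + (\<integral>x. (f x i)\<^sup>2 \<partial>\<mu>)))"
    by (intro tame_sum tame_add tame_cmult tame_integral[OF NN] tame_integral[OF N] one f1
        finite_atLeastAtMost tame_const[OF _ order_refl]) auto
  ultimately show ?thesis by simp
qed

section \<open>Parameter vectors of neurons and their normalization\<close>

text \<open>\<open>pos l k i j\<close> is the index in \<open>{1..d}\<close> of the \<open>j\<close>-th entry of \<open>V\<^sup>k\<^sub>i\<close>.\<close>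

definition pos :: "(nat \<Rightarrow> nat) \<Rightarrow> nat \<Rightarrow> nat \<Rightarrow> nat \<Rightarrow> nat" where
  "pos l k i j = (if j \<le> l (k - 1) then (i - 1) * l (k - 1) + j else l k * l (k - 1) + i)
     + offset l (k - 1)"

lemma V_eq_pos: "V idx l k \<theta> i = (\<lambda>j\<in>{1..l (k - 1) + 1}. \<theta> $ idx (pos l k i j))"
  by (auto simp: V_def weight_def bias_def pos_def)

lemma offset_Suc: "offset l (Suc k) = offset l k + l (Suc k) * (l k + 1)"
  by (simp add: offset_def)

lemma offset_mono: "k \<le> k' \<Longrightarrow> offset l k \<le> offset l k'"
  by (rule lift_Suc_mono_le[of "offset l"]) (simp_all add: offset_Suc)

lemma weight_index_le:
  fixes i j m n :: nat
  assumes "1 \<le> i" "i \<le> m" "j \<le> n"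
  shows "(i - 1) * n + j \<le> m * n"
proof -
  have "(i - 1) * n + j \<le> (i - 1) * n + n" using assms by simp
  also have "\<dots> = i * n" using assms(1) by (cases i) auto
  also have "\<dots> \<le> m * n" using assms by simp
  finally show ?thesis .
qed

lemma pos_bounds:
  assumes "k \<ge> 1" "i \<in> {1..l k}" "j \<in> {1..l (k - 1) + 1}"
  shows "offset l (k - 1) < pos l k i j" "pos l k i j \<le> offset l k"
proof -
  show "offset l (k - 1) < pos l k i j"
    using assms by (auto simp: pos_def)
  have "offset l k = offset l (k - 1) + l k * (l (k - 1) + 1)"
    using offset_Suc[of l "k - 1"] assms(1) by simp
  moreover have "(i - 1) * l (k - 1) + j \<le> l k * l (k - 1)" if "j \<le> l (k - 1)"
    using weight_index_le[of i "l k" j "l (k - 1)"] assms that by simp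
  ultimately show "pos l k i j \<le> offset l k"
    using assms by (auto simp: pos_def)
qed

lemma mult_add_pos_inject:
  fixes i i' j j' n :: nat
  assumes "i * n + j = i' * n + j'" "j \<in> {1..n}" "j' \<in> {1..n}"
  shows "i = i' \<and> j = j'"
proof -
  \<comment> \<open>Columns are numbered from 1, and subtracting 1 turns them into remainders modulo
    \<open>n\<close>.\<close>
  have "i * n + (j - 1) = i' * n + (j' - 1)" and *: "j - 1 < n" "j' - 1 < n"
    using assms by auto
  then have "(i * n + (j - 1)) div n = (i' * n + (j' - 1)) div n"
    "(i * n + (j - 1)) mod n = (i' * n + (j' - 1)) mod n" by presburger+
  then have "i = i'" "j - 1 = j' - 1"
    using * by (simp_all del: diff_Suc_1 add: div_mult_self3 mod_mult_self3)
  with assms(2,3) show ?thesis by auto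
qed

text \<open>Layers occupy consecutive blocks of indices. Inside a block the weights stand row by
  row, so quotient and remainder recover row and column, and the biases come after all of
  them.\<close>

lemma pos_inject:
  assumes "k \<ge> 1" "i \<in> {1..l k}" "j \<in> {1..l (k - 1) + 1}"
    and "k' \<ge> 1" "i' \<in> {1..l k'}" "j' \<in> {1..l (k' - 1) + 1}"
    and eq: "pos l k i j = pos l k' i' j'"
  shows "k = k' \<and> i = i' \<and> j = j'"
proof -
  have "k = k'"
  proof (rule ccontr)
    assume "k \<noteq> k'"
    then consider "k \<le> k' - 1" | "k' \<le> k - 1" by linarith
    then show False
      using pos_bounds[OF assms(1-3)] pos_bounds[OF assms(4-6)] eq
        offset_mono[of k "k' - 1" l] offset_mono[of k' "k - 1" l]
      by cases linarith+
  qed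
  moreover have "i = i' \<and> j = j'"
  proof (cases "j \<le> l (k - 1) \<and> j' \<le> l (k - 1)")
    case True
    then have "i - 1 = i' - 1 \<and> j = j'"
      using eq assms \<open>k = k'\<close> by (intro mult_add_pos_inject[of _ "l (k - 1)"]) (auto simp: pos_def)
    then show ?thesis using assms by auto
  next
    case False
    have "(i - 1) * l (k - 1) + j < l k * l (k - 1) + i'" if "j \<le> l (k - 1)"
      using weight_index_le[of i "l k" j "l (k - 1)"] assms that by simp
    moreover have "(i' - 1) * l (k - 1) + j' < l k * l (k - 1) + i" if "j' \<le> l (k - 1)"
      using weight_index_le[of i' "l k" j' "l (k - 1)"] assms that \<open>k = k'\<close> by simp
    ultimately show ?thesis
      using eq assms False \<open>k = k'\<close> by (auto simp: pos_def split: if_splits)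
  qed
  ultimately show ?thesis by simp
qed

section \<open>Gradients of the squared norms and their orthogonality\<close>

definition coords :: "(nat \<Rightarrow> 'd) \<Rightarrow> (nat \<Rightarrow> nat) \<Rightarrow> nat \<Rightarrow> nat \<Rightarrow> 'd set" where
  "coords idx l k i = (\<lambda>j. idx (pos l k i j)) ` {1..l (k - 1) + 1}"

lemma idx_pos_inject:
  assumes idx: "inj_on idx {1..offset l L}"
    and "k \<in> {1..L}" "i \<in> {1..l k}" "j \<in> {1..l (k - 1) + 1}"
    and "k' \<in> {1..L}" "i' \<in> {1..l k'}" "j' \<in> {1..l (k' - 1) + 1}"
    and eq: "idx (pos l k i j) = idx (pos l k' i' j')"
  shows "k = k' \<and> i = i' \<and> j = j'"
proof (rule pos_inject)
  have "pos l k i j \<in> {1..offset l L}" "pos l k' i' j' \<in> {1..offset l L}"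
    using pos_bounds[of k i l j] pos_bounds[of k' i' l j'] assms
      offset_mono[of k L l] offset_mono[of k' L l] by auto
  then show "pos l k i j = pos l k' i' j'"
    using inj_onD[OF idx eq] by blast
qed (use assms in auto)

lemma coords_disjoint:
  assumes "inj_on idx {1..offset l L}"
    and "k \<in> {1..L}" "i \<in> {1..l k}" "k' \<in> {1..L}" "i' \<in> {1..l k'}" "(k, i) \<noteq> (k', i')"
  shows "coords idx l k i \<inter> coords idx l k' i' = {}"
  using idx_pos_inject[OF assms(1-3) _ assms(4,5)] assms(6) unfolding coords_def by blast

lemma psi_eq_sum:
  assumes "inj_on idx {1..offset l L}" "k \<in> {1..L}" "i \<in> {1..l k}"
  shows "psi idx l k i \<theta> = (\<Sum>m\<in>coords idx l k i. (\<theta> $ m)\<^sup>2)"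
proof -
  have "inj_on (\<lambda>j. idx (pos l k i j)) {1..l (k - 1) + 1}"
    using idx_pos_inject[OF assms _ assms(2,3)] by (auto intro!: inj_onI)
  then have "(\<Sum>m\<in>coords idx l k i. (\<theta> $ m)\<^sup>2) = (\<Sum>j=1..l (k - 1) + 1. (\<theta> $ idx (pos l k i j))\<^sup>2)"
    unfolding coords_def by (simp add: sum.reindex)
  also have "\<dots> = psi idx l k i \<theta>"
    unfolding psi_def norm_V_def L2_set_def V_eq_pos
    by (subst real_sqrt_pow2[OF sum_nonneg]) (auto intro!: sum.cong)
  finally show ?thesis ..
qed

text \<open>\<open>psi\<close> is the squared norm of a coordinate projection of the parameter, so
  its gradient is twice that projection.\<close>

lemma gderiv_psi:
  fixes idx :: "nat \<Rightarrow> 'd::finite"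
  assumes "inj_on idx {1..offset l L}" "k \<in> {1..L}" "i \<in> {1..l k}"
  shows "GDERIV (psi idx l k i) \<theta> :> (\<chi> m. if m \<in> coords idx l k i then 2 * \<theta> $ m else 0)"
proof -
  let ?S = "coords idx l k i"
  have "((\<lambda>\<theta>. \<Sum>m\<in>?S. (\<theta> $ m)\<^sup>2) has_derivative (\<lambda>h. \<Sum>m\<in>?S. 2 * (\<theta> $ m) * h $ m)) (at \<theta>)"
    by (auto intro!: derivative_eq_intros bounded_linear.has_derivative[OF bounded_linear_vec_nth]
        simp: mult_ac)
  moreover have "(\<Sum>m\<in>?S. 2 * (\<theta> $ m) * h $ m)
      = h \<bullet> (\<chi> m. if m \<in> ?S then 2 * \<theta> $ m else 0)" for h :: "real ^ 'd"
    unfolding inner_vec_def by (auto simp: sum.If_cases if_distrib mult_ac cong: if_cong)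
  ultimately show ?thesis
    by (simp add: gderiv_def psi_eq_sum[OF assms, abs_def])
qed

lemma grad_psi:
  fixes idx :: "nat \<Rightarrow> 'd::finite"
  assumes "inj_on idx {1..offset l L}" "k \<in> {1..L}" "i \<in> {1..l k}"
  shows "grad (psi idx l k i) \<theta> = (\<chi> m. if m \<in> coords idx l k i then 2 * \<theta> $ m else 0)"
  using gderiv_psi[OF assms] by (rule grad_eqI)

lemma continuous_on_grad_psi:
  fixes idx :: "nat \<Rightarrow> 'd::finite"
  assumes "inj_on idx {1..offset l L}" "k \<in> {1..L}" "i \<in> {1..l k}"
  shows "continuous_on UNIV (grad (psi idx l k i))"
proof -
  have "continuous_on UNIV (\<lambda>\<theta> :: real ^ 'd. \<chi> m. if m \<in> coords idx l k i then 2 * \<theta> $ m else 0)"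
  proof (rule continuous_on_vec_lambda)
    show "continuous_on UNIV (\<lambda>\<theta> :: real ^ 'd. if m \<in> coords idx l k i then 2 * \<theta> $ m else 0)" for m
      by (cases "m \<in> coords idx l k i") (auto intro!: continuous_intros)
  qed
  then show ?thesis
    by (simp add: grad_psi[OF assms, abs_def])
qed

lemma grad_psi_orthogonal:
  fixes idx :: "nat \<Rightarrow> 'd::finite"
  assumes "inj_on idx {1..offset l L}"
    and "k \<in> {1..L}" "i \<in> {1..l k}" "k' \<in> {1..L}" "i' \<in> {1..l k'}" "(k, i) \<noteq> (k', i')"
  shows "grad (psi idx l k i) \<theta> \<bullet> grad (psi idx l k' i') \<theta> = 0"
  unfolding grad_psi[OF assms(1-3)] grad_psi[OF assms(1,4,5)] inner_vec_def
  using coords_disjoint[OF assms] by (intro sum.neutral) auto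

lemma rho_eq_scaleR: "\<exists>c. rho x = c *\<^sub>R x"
  by (auto simp: rho_def)

text \<open>The nonzero \<open>rho (v i)\<close> are orthonormal, so \<open>h\<close> is the
  projection of \<open>g\<close> onto their orthogonal complement; a vanishing \<open>v i\<close>
  contributes nothing, as \<open>rho 0 = 0\<close>. The second claim holds because
  \<open>g - h\<close> lies in the span that \<open>h\<close> is orthogonal to.\<close>

lemma orthogonal_residual:
  fixes v :: "'i \<Rightarrow> 'a::real_inner"
  assumes "finite I" and orth: "\<And>i j. i \<in> I \<Longrightarrow> j \<in> I \<Longrightarrow> i \<noteq> j \<Longrightarrow> v i \<bullet> v j = 0"
    and h: "h = g - (\<Sum>i\<in>I. (rho (v i) \<bullet> g) *\<^sub>R rho (v i))"
  shows "i \<in> I \<Longrightarrow> v i \<bullet> h = 0" and "g \<bullet> h = h \<bullet> h"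
proof -
  have *: "v i \<bullet> h = 0" if "i \<in> I" for i
  proof -
    have "v i \<bullet> (\<Sum>j\<in>I. (rho (v j) \<bullet> g) *\<^sub>R rho (v j)) = (\<Sum>j\<in>I. (rho (v j) \<bullet> g) * (v i \<bullet> rho (v j)))"
      by (simp add: inner_sum_right)
    also have "\<dots> = (\<Sum>j\<in>{i}. (rho (v j) \<bullet> g) * (v i \<bullet> rho (v j)))"
    proof (rule sum.mono_neutral_right)
      show "\<forall>j\<in>I - {i}. (rho (v j) \<bullet> g) * (v i \<bullet> rho (v j)) = 0"
        using orth that rho_eq_scaleR by (metis DiffE inner_scaleR_right insertCI mult_zero_right)
    qed (use that assms in auto)
    \<comment> \<open>For \<open>v i = 0\<close> both sides vanish; otherwise the two normalizing
      factors cancel against the squared norm of \<open>v i\<close>.\<close>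
    also have "\<dots> = v i \<bullet> g"
      by (cases "v i = 0") (simp_all add: rho_def field_simps dot_square_norm power2_eq_square)
    finally show ?thesis
      by (simp add: h inner_diff_right)
  qed
  then show "i \<in> I \<Longrightarrow> v i \<bullet> h = 0" .
  have "rho (v i) \<bullet> h = 0" if "i \<in> I" for i
    using *[OF that] rho_eq_scaleR[of "v i"] by auto
  then have "(\<Sum>i\<in>I. (rho (v i) \<bullet> g) *\<^sub>R rho (v i)) \<bullet> h = 0"
    by (simp add: inner_sum_left)
  then have "(g - h) \<bullet> h = 0" by (simp add: h)
  then show "g \<bullet> h = h \<bullet> h" by (simp add: inner_diff_left)
qed

section \<open>Effect of the renormalization on the norms\<close>

lemma L2_set_rho_fun:
  assumes "L2_set x {1..n} \<noteq> 0"
  shows "L2_set (rho_fun n x) {1..n} = 1"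
proof -
  have "L2_set (rho_fun n x) {1..n} = L2_set (\<lambda>j. inverse (L2_set x {1..n}) * x j) {1..n}"
    using assms by (intro L2_set_cong) (auto simp: rho_fun_def)
  also have "\<dots> = inverse (L2_set x {1..n}) * L2_set x {1..n}"
    by (rule L2_set_right_distrib[symmetric]) (simp add: L2_set_nonneg)
  finally show ?thesis using assms by simp
qed

lemma L2_set_pos_iff: "finite A \<Longrightarrow> L2_set x A > 0 \<longleftrightarrow> (\<exists>j\<in>A. x j \<noteq> 0)"
  using L2_set_nonneg[of x A] by (auto simp: less_le L2_set_eq_0_iff)

lemma L2_set_diag_mult_pos:
  assumes "L2_set x {1..n} > 0" "\<And>j. j \<in> {1..n} \<Longrightarrow> c j \<noteq> 0"
  shows "L2_set (diag_mult n c x) {1..n} > 0"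
  using assms by (fastforce simp: L2_set_pos_iff diag_mult_def)

text \<open>The induction carries positivity for all hidden layers, since step \<open>k\<close>
  rescales layer \<open>k + 1\<close> before that layer is normalized itself. The scaling factors
  are the norms of layer \<open>k\<close> before its normalization, with a final 1 for the bias; all
  are nonzero, so no vector becomes zero. Layers below \<open>k\<close> are no longer touched and
  keep norm 1.\<close>

lemma norm_V_renormalization:
  fixes \<Psi> :: "nat \<Rightarrow> real ^ 'd \<Rightarrow> real ^ 'd::finite"
  assumes zero: "\<forall>\<theta>. \<Psi> 0 \<theta> = \<theta>"
    and step: "\<forall>k\<in>{1..L - 1}. \<forall>K\<in>{1..L}. \<forall>i\<in>{1..l K}. \<forall>\<theta>.
          V idx l K (\<Psi> k \<theta>) i =
            (if K = k then rho_fun (l (K - 1) + 1) (V idx l K (\<Psi> (k - 1) \<theta>) i)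
             else if K = k + 1 then
               diag_mult (l k + 1)
                 (\<lambda>j. if j \<le> l k then norm_V idx l k (\<Psi> (k - 1) \<theta>) j else 1)
                 (V idx l K (\<Psi> (k - 1) \<theta>) i)
             else V idx l K (\<Psi> (k - 1) \<theta>) i)"
    and pos: "\<And>m j. m \<in> {1..L - 1} \<Longrightarrow> j \<in> {1..l m} \<Longrightarrow> norm_V idx l m \<theta> j > 0"
    and "k \<le> L - 1"
  shows "m \<in> {1..L - 1} \<Longrightarrow> j \<in> {1..l m} \<Longrightarrow>
    norm_V idx l m (\<Psi> k \<theta>) j > 0 \<and> (m \<le> k \<longrightarrow> norm_V idx l m (\<Psi> k \<theta>) j = 1)"
  using \<open>k \<le> L - 1\<close>
proof (induction k arbitrary: m j)
  case 0
  then show ?case using pos zero by simp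
next
  case (Suc k)
  have IH: "norm_V idx l m (\<Psi> k \<theta>) j > 0" "m \<le> k \<longrightarrow> norm_V idx l m (\<Psi> k \<theta>) j = 1"
    if "m \<in> {1..L - 1}" "j \<in> {1..l m}" for m j
    using Suc.IH[OF that] Suc.prems(3) by auto
  have "m \<le> L"
    using Suc.prems(1) by auto
  have V: "V idx l m (\<Psi> (Suc k) \<theta>) j =
      (if m = Suc k then rho_fun (l (m - 1) + 1) (V idx l m (\<Psi> k \<theta>) j)
       else if m = Suc (Suc k) then
         diag_mult (l (Suc k) + 1)
           (\<lambda>j. if j \<le> l (Suc k) then norm_V idx l (Suc k) (\<Psi> k \<theta>) j else 1)
           (V idx l m (\<Psi> k \<theta>) j)
       else V idx l m (\<Psi> k \<theta>) j)"
    using step[rule_format, of "Suc k" m j \<theta>, unfolded diff_Suc_1] Suc.prems \<open>m \<le> L\<close> by simp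
  consider "m = Suc k" | "m = Suc (Suc k)" | "m \<noteq> Suc k" "m \<noteq> Suc (Suc k)" by blast
  then show ?case
  proof cases
    case 1
    then have "norm_V idx l m (\<Psi> (Suc k) \<theta>) j = 1"
      using V IH(1)[OF Suc.prems(1,2)] L2_set_rho_fun unfolding norm_V_def by force
    then show ?thesis by simp
  next
    case 2
    have "norm_V idx l (Suc k) (\<Psi> k \<theta>) j > 0" if "j \<in> {1..l (Suc k)}" for j
      using IH(1)[of "Suc k"] Suc.prems(3) that by simp
    then have "L2_set (diag_mult (l (Suc k) + 1)
        (\<lambda>j. if j \<le> l (Suc k) then norm_V idx l (Suc k) (\<Psi> k \<theta>) j else 1)
        (V idx l m (\<Psi> k \<theta>) j)) {1..l (Suc k) + 1} > 0"
      using IH(1)[OF Suc.prems(1,2)] 2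
      by (intro L2_set_diag_mult_pos) (auto simp: norm_V_def less_imp_neq[symmetric])
    then have "norm_V idx l m (\<Psi> (Suc k) \<theta>) j > 0"
      using V 2 by (simp add: norm_V_def[of idx l "Suc (Suc k)" "\<Psi> (Suc k) \<theta>"])
    then show ?thesis using 2 by simp
  next
    case 3
    then show ?thesis
      using V IH[OF Suc.prems(1,2)] by (auto simp: norm_V_def)
  qed
qed

section \<open>Monotonicity of the loss along the flow\<close>

lemma flow_increment:
  fixes X g :: "real \<Rightarrow> 'a::euclidean_space"
  assumes int: "\<And>t. t \<ge> 0 \<Longrightarrow> g absolutely_integrable_on {0..t}"
    and X: "\<And>t. t \<ge> 0 \<Longrightarrow> X t = x0 - integral {0..t} g"
    and "0 \<le> s" "s \<le> t"
  shows "X t - X s = integral {s..t} (\<lambda>u. - g u)"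
proof -
  have "g integrable_on {0..t}"
    using int[of t] assms by (simp add: absolutely_integrable_on_def)
  then have "integral {0..t} g = integral {0..s} g + integral {s..t} g"
    using assms by (intro Henstock_Kurzweil_Integration.integral_combine[symmetric])
  moreover have "X t = x0 - integral {0..t} g" "X s = x0 - integral {0..s} g"
    using assms by auto
  ultimately show ?thesis by simp
qed

text \<open>The curve has compact image, so the locally uniform gradient bound gives one constant
  \<open>C\<close> along it, and \<open>C * norm (g u)\<close> dominates the integrands. The limit
  gradient enters solely as a pointwise limit. A single \<open>D\<close> serves all curves, whence
  the quantifiers inside the existential.\<close>

lemma tame_chain_rule_limit:
  fixes F :: "enat \<Rightarrow> 'a::euclidean_space \<Rightarrow> real"
  assumes "tame e M (\<lambda>r \<theta> _. F r \<theta>)" and "space M \<noteq> {}"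
  shows "\<exists>D. (\<forall>\<theta>. (\<lambda>n. grad (F (enat n)) \<theta>) \<longlonglongrightarrow> D \<theta>) \<and>
    (\<forall>(c :: real \<Rightarrow> 'a) g s t. s \<le> t \<longrightarrow> g absolutely_integrable_on {s..t} \<longrightarrow>
      (\<forall>u v. s \<le> u \<longrightarrow> u \<le> v \<longrightarrow> v \<le> t \<longrightarrow> c v - c u = integral {u..v} g) \<longrightarrow>
      F \<infinity> (c t) - F \<infinity> (c s) = integral {s..t} (\<lambda>u. D (c u) \<bullet> g u))"
proof -
  obtain DF where DF: "tame_with e M (\<lambda>r \<theta> _. F r \<theta>) DF"
    using assms(1) by (auto simp: tame_def)
  \<comment> \<open>The values do not depend on the input, but the hidden gradient family formally
    may; evaluating it at any one point removes this dependence.\<close>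
  obtain x where x: "x \<in> space M"
    using assms(2) by auto
  define D where "D r \<theta> = DF r \<theta> x" for r \<theta>
  have der: "GDERIV (F (enat n)) \<theta> :> D (enat n) \<theta>" and cont: "continuous_on UNIV (D (enat n))" for n \<theta>
    using tame_withD(3,4)[OF DF x] by (simp_all add: D_def[abs_def])
  have limF: "(\<lambda>n. F (enat n) \<theta>) \<longlonglongrightarrow> F \<infinity> \<theta>" and limD: "(\<lambda>n. D (enat n) \<theta>) \<longlonglongrightarrow> D \<infinity> \<theta>" for \<theta>
    using tame_withD(5,6)[OF DF x, THEN conv_to_imp_tendsto] by (simp_all add: D_def)
  show ?thesis
  proof (intro exI[of _ "D \<infinity>"] conjI allI impI)
    show "(\<lambda>n. grad (F (enat n)) \<theta>) \<longlonglongrightarrow> D \<infinity> \<theta>" for \<theta>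
      using limD by (simp add: grad_eqI[OF der])
    fix c g :: "real \<Rightarrow> 'a" and s t :: real
    assume "s \<le> t" and g: "g absolutely_integrable_on {s..t}"
      and "\<forall>u v. s \<le> u \<longrightarrow> u \<le> v \<longrightarrow> v \<le> t \<longrightarrow> c v - c u = integral {u..v} g"
    then have c: "\<And>u v. s \<le> u \<Longrightarrow> u \<le> v \<Longrightarrow> v \<le> t \<Longrightarrow> c v - c u = integral {u..v} g"
      by blast
    have ngi: "g integrable_on {s..t}" "(\<lambda>u. norm (g u)) integrable_on {s..t}"
      using g by (auto simp: absolutely_integrable_on_def)
    have cont_c: "continuous_on {s..t} c"
      using ngi(1) c by (rule continuous_on_of_increments)
    then have "bounded (c ` {s..t})"
      by (simp add: compact_continuous_image compact_imp_bounded)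
    then obtain B where B: "\<And>u. u \<in> {s..t} \<Longrightarrow> c u \<in> cball 0 B"
      unfolding bounded_iff by (metis imageI mem_cball_0)
    obtain C where C: "\<And>r \<theta>. \<theta> \<in> cball 0 B \<Longrightarrow> norm (D r \<theta>) \<le> C"
      using tame_with_bound[OF DF, of B] x unfolding D_def by metis
    have "(\<lambda>n. integral {s..t} (\<lambda>u. D (enat n) (c u) \<bullet> g u)) \<longlonglongrightarrow>
        integral {s..t} (\<lambda>u. D \<infinity> (c u) \<bullet> g u)"
    proof (rule dominated_convergence)
      fix n
      have "continuous_on {s..t} (\<lambda>u. D (enat n) (c u))"
        using continuous_on_compose2[OF cont cont_c] by simp
      then show "(\<lambda>u. D (enat n) (c u) \<bullet> g u) integrable_on {s..t}"
        using absolutely_integrable_inner_continuous[OF g] by (simp add: absolutely_integrable_on_def)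
      show "(\<lambda>u. C * norm (g u)) integrable_on {s..t}"
        using ngi(2) by (rule integrable_on_mult_right)
      fix u assume u: "u \<in> {s..t}"
      show "norm (D (enat n) (c u) \<bullet> g u) \<le> C * norm (g u)"
        using Cauchy_Schwarz_ineq2[of "D (enat n) (c u)" "g u"]
          mult_right_mono[OF C[OF B[OF u], of "enat n"] norm_ge_zero[of "g u"]] by simp
      show "(\<lambda>n. D (enat n) (c u) \<bullet> g u) \<longlonglongrightarrow> D \<infinity> (c u) \<bullet> g u"
        by (intro tendsto_intros limD)
    qed
    moreover have "integral {s..t} (\<lambda>u. D (enat n) (c u) \<bullet> g u) = F (enat n) (c t) - F (enat n) (c s)" for n
      using gderiv_chain_rule_integral[OF \<open>s \<le> t\<close> g c der cont] by simp
    ultimately have "(\<lambda>n. F (enat n) (c t) - F (enat n) (c s)) \<longlonglongrightarrow>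
        integral {s..t} (\<lambda>u. D \<infinity> (c u) \<bullet> g u)"
      by simp
    moreover have "(\<lambda>n. F (enat n) (c t) - F (enat n) (c s)) \<longlonglongrightarrow> F \<infinity> (c t) - F \<infinity> (c s)"
      by (intro tendsto_diff limF)
    ultimately show "F \<infinity> (c t) - F \<infinity> (c s) = integral {s..t} (\<lambda>u. D \<infinity> (c u) \<bullet> g u)"
      by (rule LIMSEQ_unique[symmetric])
  qed
qed

lemma Min_norm_V_pos:
  assumes "Min ((\<lambda>(m, j). norm_V idx l m \<theta> j) ` Lam L l) > 0" "(k, i) \<in> Lam L l"
  shows "norm_V idx l k \<theta> i > 0"
proof -
  have "finite (Lam L l)" by (simp add: Lam_def)
  then have "Min ((\<lambda>(m, j). norm_V idx l m \<theta> j) ` Lam L l) \<le> norm_V idx l k \<theta> i"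
    using assms(2) by (intro Min_le) force+
  with assms(1) show ?thesis by linarith
qed

theorem proposition2p9:
  fixes a b :: real
    and L :: nat
    and l :: "nat \<Rightarrow> nat"
    and idx :: "nat \<Rightarrow> 'd::finite"
    and R :: "enat \<Rightarrow> real \<Rightarrow> real"
    and \<mu> :: "(nat \<Rightarrow> real) measure"
    and f :: "(nat \<Rightarrow> real) \<Rightarrow> nat \<Rightarrow> real"
    and loss :: "enat \<Rightarrow> real ^ 'd \<Rightarrow> real"
    and \<G> G \<phi> :: "real ^ 'd \<Rightarrow> real ^ 'd"
    and \<Psi> :: "nat \<Rightarrow> real ^ 'd \<Rightarrow> real ^ 'd"
    and P :: "'w measure"
    and \<xi> :: "'w \<Rightarrow> real ^ 'd"
    and \<Theta> :: "real \<Rightarrow> 'w \<Rightarrow> real ^ 'd"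
    and \<gamma> :: "nat \<Rightarrow> real"
    and \<theta>' :: "nat \<Rightarrow> 'w \<Rightarrow> real ^ 'd"
  assumes "a < b"
    and "L \<ge> 2"
    and "\<forall>k\<le>L. l k \<ge> 1"
    and "bij_betw idx {1..\<Sum>k=1..L. l k * (l (k - 1) + 1)} UNIV"
    and "\<forall>r::nat. r \<ge> 1 \<longrightarrow> R (enat r) C1_differentiable_on UNIV"
    and "\<forall>x. R \<infinity> x = max x 0"
    and "\<forall>x. (SUP r\<in>{1::nat..}. SUP y\<in>{-\<bar>x\<bar>..\<bar>x\<bar>}. ereal \<bar>deriv (R (enat r)) y\<bar>) < \<infinity>"
    and "\<forall>x. limsup (\<lambda>N. \<Sum>r. indicator {0<..}
            (\<bar>R (enat (N + r)) x - R \<infinity> x\<bar>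
              + \<bar>deriv (R (enat (N + r))) x - indicator {0<..} x\<bar>) :: ennreal) = 0"
    and "finite_measure \<mu>"
    and "sets \<mu> = sets (borel_cube (l 0) a b)"
    and "f \<in> measurable (borel_cube (l 0) a b) (\<Pi>\<^sub>M i\<in>{1..l L}. borel)"
    and "\<forall>r \<theta>. r \<noteq> 0 \<longrightarrow>
          has_bochner_integral \<mu>
            (\<lambda>x. (L2_set (\<lambda>i. realization idx L l \<mu> (R r) \<theta> L x i - f x i) {1..l L})\<^sup>2)
            (loss r \<theta>)"
    and "\<forall>\<theta>. convergent (\<lambda>r. grad (loss (enat r)) \<theta>) \<longrightarrow>
          \<G> \<theta> = lim (\<lambda>r. grad (loss (enat r)) \<theta>)"
    and "\<forall>\<theta>. G \<theta> = \<G> \<theta> - (\<Sum>(k, i)\<in>Lam L l.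
          (rho (grad (psi idx l k i) \<theta>) \<bullet> \<G> \<theta>) *\<^sub>R rho (grad (psi idx l k i) \<theta>))"
    and "\<forall>\<theta>. \<forall>k\<in>{1..L}. \<forall>i\<in>{1..l k}.
          V idx l k (\<phi> \<theta>) i =
            (if k < L then rho_fun (l (k - 1) + 1) (V idx l k \<theta> i) else V idx l k \<theta> i)"
    and "\<forall>\<theta>. \<Psi> 0 \<theta> = \<theta>"
    and "\<forall>k\<in>{1..L - 1}. \<forall>K\<in>{1..L}. \<forall>i\<in>{1..l K}. \<forall>\<theta>.
          V idx l K (\<Psi> k \<theta>) i =
            (if K = k then rho_fun (l (K - 1) + 1) (V idx l K (\<Psi> (k - 1) \<theta>) i)
             else if K = k + 1 then
               diag_mult (l k + 1)
                 (\<lambda>j. if j \<le> l k then norm_V idx l k (\<Psi> (k - 1) \<theta>) j else 1)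
                 (V idx l K (\<Psi> (k - 1) \<theta>) i)
             else V idx l K (\<Psi> (k - 1) \<theta>) i)"
    and "prob_space P"
    and "\<xi> \<in> borel_measurable P"
    and "\<forall>t\<ge>0. \<forall>\<omega>\<in>space P. (\<lambda>s. G (\<Theta> s \<omega>)) absolutely_integrable_on {0..t}"
    and "\<forall>t\<ge>0. \<forall>\<omega>\<in>space P.
          \<Theta> t \<omega> = \<Psi> (L - 1) (\<xi> \<omega>) - integral {0..t} (\<lambda>s. G (\<Theta> s \<omega>))"
    and "\<forall>\<omega>\<in>space P. \<theta>' 0 \<omega> = \<Psi> (L - 1) (\<xi> \<omega>)"
    and "\<forall>n. \<forall>\<omega>\<in>space P. \<theta>' (Suc n) \<omega> = \<phi> (\<theta>' n \<omega> - \<gamma> n *\<^sub>R G (\<theta>' n \<omega>))"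
  shows "(\<forall>(k, i)\<in>Lam L l. \<forall>t\<ge>0. \<forall>\<omega>\<in>space P.
            Min ((\<lambda>(m, j). norm_V idx l m (\<xi> \<omega>) j) ` Lam L l) > 0 \<longrightarrow>
            psi idx l k i (\<Theta> t \<omega>) = 1)
    \<and> (\<forall>s\<ge>0. \<forall>t\<ge>s. \<forall>\<omega>\<in>space P.
            Min ((\<lambda>(m, j). norm_V idx l m (\<xi> \<omega>) j) ` Lam L l) > 0 \<longrightarrow>
            loss \<infinity> (\<Theta> t \<omega>) \<le> loss \<infinity> (\<Theta> s \<omega>))
    \<and> (\<forall>(k, i)\<in>Lam L l. \<forall>n. \<forall>\<omega>\<in>space P.
            Min ((\<lambda>(m, j). norm_V idx l m (\<theta>' n \<omega> - \<gamma> n *\<^sub>R G (\<theta>' n \<omega>)) j) ` Lam L l) > 0 \<longrightarrow>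
            psi idx l k i (\<theta>' (Suc n) \<omega>) = 1)"
proof -
  have idx: "inj_on idx {1..offset l L}"
    using assms(4) by (simp add: bij_betw_def offset_def)
  have Lam: "k \<in> {1..L}" "i \<in> {1..l k}" "k \<in> {1..L - 1}" "k < L" if "(k, i) \<in> Lam L l" for k i
    using that by (auto simp: Lam_def)
  have Lam_iff: "(k, i) \<in> Lam L l \<longleftrightarrow> k \<in> {1..L - 1} \<and> i \<in> {1..l k}" for k i
    by (auto simp: Lam_def)
  have finLam: "finite (Lam L l)" by (simp add: Lam_def)
  define gpsi where "gpsi \<theta> = (\<lambda>(k, i). grad (psi idx l k i) \<theta>)" for \<theta>
  have orth: "gpsi \<theta> p \<bullet> gpsi \<theta> q = 0" if "p \<in> Lam L l" "q \<in> Lam L l" "p \<noteq> q" for p q \<theta>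
    using that Lam grad_psi_orthogonal[OF idx] by (cases p; cases q) (simp add: gpsi_def)
  have G: "G \<theta> = \<G> \<theta> - (\<Sum>p\<in>Lam L l. (rho (gpsi \<theta> p) \<bullet> \<G> \<theta>) *\<^sub>R rho (gpsi \<theta> p))" for \<theta>
    using assms(14) by (simp add: gpsi_def case_prod_unfold)
  note residual = orthogonal_residual[OF finLam orth G]

  have act: "activation (\<lambda>r. R (eSuc r)) (\<lambda>r. if r = \<infinity> then indicator {0<..} else deriv (R (eSuc r)))"
    by (rule activationI) (use assms in blast)+
  \<comment> \<open>After the shift by \<open>eSuc\<close> every index is nonzero, so the hypothesis
    on the losses covers the whole family.\<close>
  have tame: "tame False \<mu> (\<lambda>r \<theta> x. loss (eSuc r) \<theta>)"
    by (rule tame_loss[where idx=idx, OF act assms(10,9,2,11)]) (use assms(12) in simp)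
  have "space \<mu> \<noteq> {}"
    using space_borel_cube[OF assms(10)] \<open>a < b\<close> by (simp add: cube_def PiE_eq_empty_iff)
  from tame_chain_rule_limit[OF tame this]
  obtain D where D: "\<forall>\<theta>. (\<lambda>n. grad (loss (eSuc (enat n))) \<theta>) \<longlonglongrightarrow> D \<theta>"
    and chain: "\<forall>(c :: real \<Rightarrow> real ^ 'd) g s t. s \<le> t \<longrightarrow> g absolutely_integrable_on {s..t} \<longrightarrow>
      (\<forall>u v. s \<le> u \<longrightarrow> u \<le> v \<longrightarrow> v \<le> t \<longrightarrow> c v - c u = integral {u..v} g) \<longrightarrow>
      loss (eSuc \<infinity>) (c t) - loss (eSuc \<infinity>) (c s) = integral {s..t} (\<lambda>u. D (c u) \<bullet> g u)"
    by blast
  have "\<G> \<theta> = D \<theta>" for \<theta>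
  proof -
    \<comment> \<open>Undoes the shift: a limit of the tail from index 1 on is a limit of the
      sequence.\<close>
    have "(\<lambda>r. grad (loss (enat r)) \<theta>) \<longlonglongrightarrow> D \<theta>"
      by (rule LIMSEQ_imp_Suc) (use D in \<open>simp only: eSuc_enat\<close>)
    then show ?thesis
      using assms(13) limI convergentI by metis
  qed
  then have D_eq: "D = \<G>" by auto

  \<comment> \<open>The last renormalization step is \<open>L - 1\<close>, by which every hidden
    layer has had its turn.\<close>
  have normalized: "psi idx l k i (\<Psi> (L - 1) \<theta>) = 1"
    if "(k, i) \<in> Lam L l" "Min ((\<lambda>(m, j). norm_V idx l m \<theta> j) ` Lam L l) > 0" for k i \<theta>
    using norm_V_renormalization[OF assms(16,17) _ order_refl, of \<theta> k i] Min_norm_V_pos[OF that(2)] that(1)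
    by (auto simp: psi_def Lam_iff)

  have G_int: "(\<lambda>u. - G (\<Theta> u \<omega>)) absolutely_integrable_on {s..t}"
    and incr: "\<Theta> t \<omega> - \<Theta> s \<omega> = integral {s..t} (\<lambda>u. - G (\<Theta> u \<omega>))"
    if "\<omega> \<in> space P" "0 \<le> s" "s \<le> t" for \<omega> s t
  proof -
    have "(\<lambda>u. G (\<Theta> u \<omega>)) absolutely_integrable_on {s..t}"
      using assms(20) that by (intro set_integrable_subset[of lebesgue "{0..t}" _ "{s..t}"]) auto
    then show "(\<lambda>u. - G (\<Theta> u \<omega>)) absolutely_integrable_on {s..t}"
      by (simp add: set_integrable_def)
    show "\<Theta> t \<omega> - \<Theta> s \<omega> = integral {s..t} (\<lambda>u. - G (\<Theta> u \<omega>))"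
      by (rule flow_increment) (use assms(20,21) that in auto)
  qed

  have psi_const: "psi idx l k i (\<Theta> t \<omega>) = psi idx l k i (\<Theta> 0 \<omega>)"
    if p: "(k, i) \<in> Lam L l" and t: "t \<ge> 0" and \<omega>: "\<omega> \<in> space P" for k i t \<omega>
  proof -
    note ki = idx Lam(1)[OF p] Lam(2)[OF p]
    have "psi idx l k i (\<Theta> t \<omega>) - psi idx l k i (\<Theta> 0 \<omega>)
        = integral {0..t} (\<lambda>u. grad (psi idx l k i) (\<Theta> u \<omega>) \<bullet> - G (\<Theta> u \<omega>))"
      using t G_int[OF \<omega>] incr[OF \<omega>] gderiv_psi[OF ki] continuous_on_grad_psi[OF ki]
      by (intro gderiv_chain_rule_integral) (auto simp: grad_psi[OF ki])
    \<comment> \<open>The integrand vanishes at every time, \<open>G\<close> being orthogonal to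
      this gradient at every parameter.\<close>
    also have "\<dots> = 0"
      using residual(1)[of "(k, i)"] p by (simp add: gpsi_def)
    finally show ?thesis by simp
  qed

  have part1: "psi idx l k i (\<Theta> t \<omega>) = 1"
    if "(k, i) \<in> Lam L l" "t \<ge> 0" "\<omega> \<in> space P"
      "Min ((\<lambda>(m, j). norm_V idx l m (\<xi> \<omega>) j) ` Lam L l) > 0" for k i t \<omega>
    using psi_const[OF that(1-3)] normalized[OF that(1,4)] assms(21) that(3) by auto

  have part2: "loss \<infinity> (\<Theta> t \<omega>) \<le> loss \<infinity> (\<Theta> s \<omega>)"
    if "0 \<le> s" "s \<le> t" and \<omega>: "\<omega> \<in> space P" for s t \<omega>
  proof -
    have "loss \<infinity> (\<Theta> t \<omega>) - loss \<infinity> (\<Theta> s \<omega>) = integral {s..t} (\<lambda>u. D (\<Theta> u \<omega>) \<bullet> - G (\<Theta> u \<omega>))"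
      using chain[rule_format, OF that(2) G_int[OF \<omega> that(1,2)], of "\<lambda>u. \<Theta> u \<omega>"] incr[OF \<omega>] that(1) by simp
    also have "\<dots> = - integral {s..t} (\<lambda>u. G (\<Theta> u \<omega>) \<bullet> G (\<Theta> u \<omega>))"
      using residual(2) by (simp add: D_eq)
    \<comment> \<open>If the squared norm of \<open>G\<close> is not integrable along the curve, its
      integral is 0 by convention, and the sign is right in either case.\<close>
    also have "\<dots> \<le> 0"
      by (cases "(\<lambda>u. G (\<Theta> u \<omega>) \<bullet> G (\<Theta> u \<omega>)) integrable_on {s..t}")
        (auto intro: Henstock_Kurzweil_Integration.integral_nonneg simp: not_integrable_integral)
    finally show ?thesis by simp
  qed

  have part3: "psi idx l k i (\<theta>' (Suc n) \<omega>) = 1"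
    if "(k, i) \<in> Lam L l" "\<omega> \<in> space P"
      "Min ((\<lambda>(m, j). norm_V idx l m (\<theta>' n \<omega> - \<gamma> n *\<^sub>R G (\<theta>' n \<omega>)) j) ` Lam L l) > 0" for k i n \<omega>
  proof -
    let ?z = "\<theta>' n \<omega> - \<gamma> n *\<^sub>R G (\<theta>' n \<omega>)"
    have "V idx l k (\<phi> ?z) i = rho_fun (l (k - 1) + 1) (V idx l k ?z i)"
      using assms(15) Lam[OF that(1)] by simp
    then have "norm_V idx l k (\<phi> ?z) i = 1"
      using Min_norm_V_pos[OF that(3,1)] L2_set_rho_fun[of "V idx l k ?z i" "l (k - 1) + 1"]
      by (simp add: norm_V_def)
    then show ?thesis
      using assms(23) that(2) by (simp add: psi_def)
  qed

  show ?thesis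
    using part1 part2 part3 by blast
qed

end
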